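(* Let $\beta>0$ be a real constant and let $V\in L^\infty(\mathcal D)$ with $V\ge 0$ on $\mathcal D$. For any $\phi\in H^1(\mathcal D)$ satisfying periodic boundary conditions and $\|\phi\|_2=1$, $$\lim_{\tau\to0^+}E^{1,\tau}(\phi)=E(\phi).$$
   Context: $\mathcal D\subset\mathbb R^d$, $d\in\{1,2,3\}$, is a bounded domain (an interval for $d=1$, a rectangle for $d=2$, a box for $d=3$), with periodic boundary conditions imposed on all functions. Functions $\phi$ are complex-valued, and $\|\cdot\|_2$ is the norm of $L^2(\mathcal D)$. $e^{t\Delta}$, $t\ge 0$, denotes the heat semigroup on $L^2(\mathcal D)$ generated by the Laplacian with periodic boundary conditions. The Gross--Pitaevskii energy is $$E(\phi)=\int_{\mathcal D}\Big(\frac12|\nabla\phi|^2+V(x)|\phi|^2+\frac\beta2|\phi|^4\Big)\,dx,$$ and for $\tau>0$ the first-order relaxed energy is $$E^{1,\tau}(\phi)=\frac1{2\tau}+\int_{\mathcal D}\Big(-\frac1{2\tau}\big|e^{\frac\tau2\Delta}\phi\big|^2+V(x)|\phi|^2+\frac\beta2|\phi|^4\Big)\,dx.$$ *)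

theory Defs
  imports "HOL-Analysis.Analysis"
begin

text \<open>
  Elements of \<open>L\<^sup>2(\<D>)\<close> are represented by functions, identified when they agree almost
  everywhere; identities in \<open>L\<^sup>2\<close> are therefore stated with \<open>AE\<close>.  The domain is the box
  \<open>\<D> = box a b\<close> in \<open>real ^ 'n\<close>, so functions on \<open>\<D>\<close> are total functions whose values outside
  the box are irrelevant.
\<close>

abbreviation box_measure :: "real ^ 'n \<Rightarrow> real ^ 'n \<Rightarrow> (real ^ 'n) measure" where
  "box_measure a b \<equiv> lebesgue_on (box a b)"

definition L2_space :: "'a measure \<Rightarrow> ('a \<Rightarrow> complex) set" where
  "L2_space M = {u. u \<in> borel_measurable M \<and> integrable M (\<lambda>x. (cmod (u x))\<^sup>2)}"

definition L2_norm :: "'a measure \<Rightarrow> ('a \<Rightarrow> complex) \<Rightarrow> real" where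
  "L2_norm M u = sqrt (LINT x|M. (cmod (u x))\<^sup>2)"

definition Linf_space :: "'a measure \<Rightarrow> ('a \<Rightarrow> real) set" where
  "Linf_space M = {V. V \<in> borel_measurable M \<and> (\<exists>C. AE x in M. \<bar>V x\<bar> \<le> C)}"


subsection \<open>Periodic Sobolev spaces\<close>

definition partial_deriv :: "'n \<Rightarrow> (real ^ 'n \<Rightarrow> complex) \<Rightarrow> real ^ 'n \<Rightarrow> complex" where
  "partial_deriv i f x = frechet_derivative f (at x) (axis i 1)"

fun C_k :: "nat \<Rightarrow> (real ^ 'n \<Rightarrow> complex) \<Rightarrow> bool" where
  "C_k 0 f \<longleftrightarrow> continuous_on UNIV f"
| "C_k (Suc k) f \<longleftrightarrow> (\<forall>x. f differentiable (at x)) \<and> (\<forall>i. C_k k (partial_deriv i f))"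

definition periodic_test :: "real ^ 'n \<Rightarrow> real ^ 'n \<Rightarrow> (real ^ 'n \<Rightarrow> complex) set" where
  "periodic_test a b =
     {\<psi>. (\<forall>k. C_k k \<psi>) \<and> (\<forall>i x. \<psi> (x + (b $ i - a $ i) *\<^sub>R axis i 1) = \<psi> x)}"

text \<open>
  Weak derivatives with periodic boundary conditions: the test functions are all smooth
  \<open>\<D>\<close>-periodic functions on the whole space, not only those with compact support in \<open>\<D>\<close>.
  Compactly supported test functions (extended periodically) make \<open>g\<close> the usual weak derivative
  on \<open>\<D>\<close>; the remaining ones make the boundary terms on opposite faces cancel, that is, they
  force the traces of \<open>u\<close> on opposite faces to agree.
\<close>

definition weak_partial ::
    "real ^ 'n \<Rightarrow> real ^ 'n \<Rightarrow> 'n \<Rightarrow> (real ^ 'n \<Rightarrow> complex) \<Rightarrow> (real ^ 'n \<Rightarrow> complex) \<Rightarrow> bool" where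
  "weak_partial a b i u g \<longleftrightarrow>
     u \<in> L2_space (box_measure a b) \<and> g \<in> L2_space (box_measure a b) \<and>
     (\<forall>\<psi>\<in>periodic_test a b.
        (LINT x|box_measure a b. u x * partial_deriv i \<psi> x) =
        - (LINT x|box_measure a b. g x * \<psi> x))"

definition H1_per :: "real ^ 'n \<Rightarrow> real ^ 'n \<Rightarrow> (real ^ 'n \<Rightarrow> complex) set" where
  "H1_per a b = {u \<in> L2_space (box_measure a b). \<forall>i. \<exists>g. weak_partial a b i u g}"

text \<open>The choice is immaterial: weak derivatives are unique up to null sets.\<close>

definition weak_deriv ::
    "real ^ 'n \<Rightarrow> real ^ 'n \<Rightarrow> 'n \<Rightarrow> (real ^ 'n \<Rightarrow> complex) \<Rightarrow> real ^ 'n \<Rightarrow> complex" where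
  "weak_deriv a b i u = (SOME g. weak_partial a b i u g)"

definition H2_per :: "real ^ 'n \<Rightarrow> real ^ 'n \<Rightarrow> (real ^ 'n \<Rightarrow> complex) set" where
  "H2_per a b = {u \<in> H1_per a b. \<forall>i. weak_deriv a b i u \<in> H1_per a b}"

definition weak_laplacian ::
    "real ^ 'n \<Rightarrow> real ^ 'n \<Rightarrow> (real ^ 'n \<Rightarrow> complex) \<Rightarrow> real ^ 'n \<Rightarrow> complex" where
  "weak_laplacian a b u x = (\<Sum>i\<in>UNIV. weak_deriv a b i (weak_deriv a b i u) x)"


subsection \<open>The heat semigroup\<close>

text \<open>
  Strongly continuous semigroups of bounded operators on \<open>L\<^sup>2\<close>, acting on representatives.
  Compatibility with almost-everywhere equality follows from linearity and boundedness.
\<close>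

definition C0_semigroup :: "'a measure \<Rightarrow> (real \<Rightarrow> ('a \<Rightarrow> complex) \<Rightarrow> 'a \<Rightarrow> complex) \<Rightarrow> bool" where
  "C0_semigroup M S \<longleftrightarrow>
     (\<forall>t\<ge>0. \<forall>u\<in>L2_space M. S t u \<in> L2_space M) \<and>
     (\<forall>t\<ge>0. \<forall>u\<in>L2_space M. \<forall>v\<in>L2_space M. \<forall>c.
        AE x in M. S t (\<lambda>y. u y + c * v y) x = S t u x + c * S t v x) \<and>
     (\<forall>t\<ge>0. \<exists>C. \<forall>u\<in>L2_space M. L2_norm M (S t u) \<le> C * L2_norm M u) \<and>
     (\<forall>u\<in>L2_space M. AE x in M. S 0 u x = u x) \<and>
     (\<forall>s\<ge>0. \<forall>t\<ge>0. \<forall>u\<in>L2_space M. AE x in M. S (s + t) u x = S s (S t u) x) \<and>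
     (\<forall>u\<in>L2_space M. ((\<lambda>t. L2_norm M (\<lambda>x. S t u x - u x)) \<longlongrightarrow> 0) (at_right 0))"

text \<open>The graph of the infinitesimal generator: \<open>u\<close> is in its domain and is mapped to \<open>f\<close>.\<close>

definition generator_graph ::
    "'a measure \<Rightarrow> (real \<Rightarrow> ('a \<Rightarrow> complex) \<Rightarrow> 'a \<Rightarrow> complex) \<Rightarrow>
     ('a \<Rightarrow> complex) \<Rightarrow> ('a \<Rightarrow> complex) \<Rightarrow> bool" where
  "generator_graph M S u f \<longleftrightarrow>
     u \<in> L2_space M \<and> f \<in> L2_space M \<and>
     ((\<lambda>h. L2_norm M (\<lambda>x. (S h u x - u x) / of_real h - f x)) \<longlongrightarrow> 0) (at_right 0)"

text \<open>
  \<open>S t\<close> is \<open>e\<^sup>t\<^sup>\<Delta>\<close>: the generator is exactly the Laplacian with domain \<open>H2_per a b\<close>.  A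
  \<open>C\<^sub>0\<close>-semigroup is determined (up to null sets) by its generator.
\<close>

definition heat_semigroup ::
    "real ^ 'n \<Rightarrow> real ^ 'n \<Rightarrow>
     (real \<Rightarrow> (real ^ 'n \<Rightarrow> complex) \<Rightarrow> real ^ 'n \<Rightarrow> complex) \<Rightarrow> bool" where
  "heat_semigroup a b S \<longleftrightarrow>
     C0_semigroup (box_measure a b) S \<and>
     (\<forall>u f. generator_graph (box_measure a b) S u f \<longleftrightarrow>
        u \<in> H2_per a b \<and> f \<in> L2_space (box_measure a b) \<and>
        (AE x in box_measure a b. f x = weak_laplacian a b u x))"


subsection \<open>Energies\<close>

definition GP_energy ::
    "real ^ 'n \<Rightarrow> real ^ 'n \<Rightarrow> (real ^ 'n \<Rightarrow> real) \<Rightarrow> real \<Rightarrow> (real ^ 'n \<Rightarrow> complex) \<Rightarrow> real" where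
  "GP_energy a b V \<beta> \<phi> =
     (LINT x|box_measure a b.
        1 / 2 * (\<Sum>i\<in>UNIV. (cmod (weak_deriv a b i \<phi> x))\<^sup>2)
        + V x * (cmod (\<phi> x))\<^sup>2 + \<beta> / 2 * (cmod (\<phi> x)) ^ 4)"

definition relaxed_energy ::
    "real ^ 'n \<Rightarrow> real ^ 'n \<Rightarrow> (real \<Rightarrow> (real ^ 'n \<Rightarrow> complex) \<Rightarrow> real ^ 'n \<Rightarrow> complex) \<Rightarrow>
     (real ^ 'n \<Rightarrow> real) \<Rightarrow> real \<Rightarrow> real \<Rightarrow> (real ^ 'n \<Rightarrow> complex) \<Rightarrow> real" where
  "relaxed_energy a b S V \<beta> \<tau> \<phi> =
     1 / (2 * \<tau>) +
     (LINT x|box_measure a b.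
        - 1 / (2 * \<tau>) * (cmod (S (\<tau> / 2) \<phi> x))\<^sup>2
        + V x * (cmod (\<phi> x))\<^sup>2 + \<beta> / 2 * (cmod (\<phi> x)) ^ 4)"

end

theory Submission
  imports Defs
begin

text \<open>
  The potential and quartic terms of the two energies coincide, and since \<open>\<phi>\<close> has norm one the claim
  reduces to \<open>(\<parallel>\<phi>\<parallel>\<^sup>2 - \<parallel>S\<^sub>t \<phi>\<parallel>\<^sup>2) / 2t \<longrightarrow> \<parallel>\<nabla>\<phi>\<parallel>\<^sup>2\<close> with \<open>t = \<tau>/2\<close>,
  together with the integrability of every term, which allows the integrals to be split.  Both are read off
  from the Fourier series of \<open>\<phi>\<close> in the periodic box.

  For the limit, let \<open>c\<^sub>k\<close> be the Fourier coefficients and \<open>\<lambda>\<^sub>k\<close> the eigenvalues of the negative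
  Laplacian.  By Parseval's identity the quotient is proportional to
  \<open>\<Sum> \<bar>c\<^sub>k\<bar>\<^sup>2 (1 - exp (-2 \<lambda>\<^sub>k t)) / 2t\<close>.  Every term increases to \<open>\<lambda>\<^sub>k \<bar>c\<^sub>k\<bar>\<^sup>2\<close> as \<open>t\<close> decreases to zero, and
  the sum of these limits is, with the same factor, the squared norm of the gradient
  (\<open>heat_energy_dissipation\<close>).

  That the semigroup acts diagonally has to be extracted from its generator.  Each character is an
  eigenvector of the Laplacian (\<open>generator_character\<close>), and \<open>C0_semigroup_eigenvector\<close> integrates this
  to \<open>S\<^sub>t e\<^sub>k = exp (-\<lambda>\<^sub>k t) e\<^sub>k\<close>.  The integration requires the operators to be uniformly bounded for
  small times; strong continuity provides this through the uniform boundedness principle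
  (\<open>C0_semigroup_locally_bounded\<close>), which in turn rests on the completeness of \<open>L\<^sup>2\<close>.

  Parseval's identity (\<open>Fourier_series_tendsto\<close>) is the completeness of the characters: a function
  orthogonal to all of them vanishes almost everywhere (\<open>AE_eq_0_of_orthogonal\<close>), by the
  Stone--Weierstrass theorem on the torus and Lebesgue's differentiation theorem.

  The quartic term is integrable because \<open>H\<^sup>1\<close> embeds into \<open>L\<^sup>4\<close> in dimension at most three
  (\<open>H1_integrable_power4\<close>); this follows from splitting the Fourier series into dyadic blocks.
\<close>

section \<open>Square-integrable functions\<close>

text \<open>
  Fatou's lemma with integrability of the limit as part of the conclusion: this is how membership in
  \<open>L\<^sup>2\<close> and \<open>L\<^sup>4\<close> passes from partial sums to limits.
\<close>

lemma integrable_Fatou: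
  fixes F :: "nat \<Rightarrow> 'a \<Rightarrow> real"
  assumes F: "\<And>m. integrable M (F m)" "\<And>m x. 0 \<le> F m x"
    and G: "G \<in> borel_measurable M"
    and lim: "AE x in M. (\<lambda>m. F m x) \<longlonglongrightarrow> G x"
    and bound: "\<And>m. (LINT x|M. F m x) \<le> B"
  shows "integrable M G \<and> (LINT x|M. G x) \<le> B"
proof -
  have pos: "AE x in M. 0 \<le> G x"
    using lim by eventually_elim (rule LIMSEQ_le_const, assumption, simp add: F(2))
  have B0: "0 \<le> B"
    by (rule order_trans[OF integral_nonneg_AE bound[of 0]]) (simp add: F(2))
  have "(\<integral>\<^sup>+x. ennreal (G x) \<partial>M) = (\<integral>\<^sup>+x. liminf (\<lambda>m. ennreal (F m x)) \<partial>M)"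
  proof (rule nn_integral_cong_AE)
    show "AE x in M. ennreal (G x) = liminf (\<lambda>m. ennreal (F m x))"
      using lim
    proof eventually_elim
      case (elim x)
      then have "(\<lambda>m. ennreal (F m x)) \<longlonglongrightarrow> ennreal (G x)"
        by (rule tendsto_ennrealI)
      then show ?case
        by (simp add: lim_imp_Liminf)
    qed
  qed
  also have "\<dots> \<le> liminf (\<lambda>m. \<integral>\<^sup>+x. ennreal (F m x) \<partial>M)"
    using F by (intro nn_integral_liminf) (auto dest: borel_measurable_integrable)
  also have "\<dots> \<le> ennreal B"
  proof -
    have "(\<integral>\<^sup>+x. ennreal (F m x) \<partial>M) \<le> ennreal B" for m
      using F bound[of m] by (subst nn_integral_eq_integral) (auto simp: ennreal_leI)
    then have "liminf (\<lambda>m. \<integral>\<^sup>+x. ennreal (F m x) \<partial>M) \<le> liminf (\<lambda>m. ennreal B)"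
      by (intro Liminf_mono) auto
    then show ?thesis by (simp add: Liminf_const)
  qed
  finally have le: "(\<integral>\<^sup>+x. ennreal (G x) \<partial>M) \<le> ennreal B" .
  have int: "integrable M G"
    using G pos le by (intro integrableI_nonneg) (auto simp: less_top[symmetric] top_unique)
  have "ennreal (LINT x|M. G x) \<le> ennreal B"
    using le nn_integral_eq_integral[OF int pos] by simp
  then show ?thesis
    using int B0 by simp
qed

lemma L2_spaceD:
  assumes "u \<in> L2_space M"
  shows "u \<in> borel_measurable M" "integrable M (\<lambda>x. (cmod (u x))\<^sup>2)"
  using assms by (auto simp: L2_space_def)

lemma L2_spaceI_bound:
  assumes "u \<in> borel_measurable M" "integrable M g" "AE x in M. (cmod (u x))\<^sup>2 \<le> g x"
  shows "u \<in> L2_space M"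
  unfolding L2_space_def
proof (intro CollectI conjI)
  show "integrable M (\<lambda>x. (cmod (u x))\<^sup>2)"
    by (rule Bochner_Integration.integrable_bound[OF assms(2)]) (use assms in auto)
qed (use assms in auto)

lemma L2_space_add:
  assumes "u \<in> L2_space M" "v \<in> L2_space M"
  shows "(\<lambda>x. u x + v x) \<in> L2_space M"
proof (rule L2_spaceI_bound)
  show "(\<lambda>x. u x + v x) \<in> borel_measurable M"
    using assms[THEN L2_spaceD(1)] by simp
  show "integrable M (\<lambda>x. 2 * (cmod (u x))\<^sup>2 + 2 * (cmod (v x))\<^sup>2)"
    using assms[THEN L2_spaceD(2)] by simp
  have "(cmod (p + q))\<^sup>2 \<le> 2 * (cmod p)\<^sup>2 + 2 * (cmod q)\<^sup>2" for p q
  proof -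
    have "(cmod (p + q))\<^sup>2 \<le> (cmod p + cmod q)\<^sup>2"
      by (intro power_mono norm_triangle_ineq) auto
    also have "\<dots> \<le> 2 * (cmod p)\<^sup>2 + 2 * (cmod q)\<^sup>2"
      using zero_le_power2[of "cmod p - cmod q"] by (simp add: power2_sum power2_diff)
    finally show ?thesis .
  qed
  then show "AE x in M. (cmod (u x + v x))\<^sup>2 \<le> 2 * (cmod (u x))\<^sup>2 + 2 * (cmod (v x))\<^sup>2"
    by simp
qed

lemma L2_space_cmult:
  assumes "u \<in> L2_space M"
  shows "(\<lambda>x. c * u x) \<in> L2_space M"
  using assms by (auto simp: L2_space_def norm_mult power_mult_distrib)

lemma L2_space_diff:
  assumes "u \<in> L2_space M" "v \<in> L2_space M"
  shows "(\<lambda>x. u x - v x) \<in> L2_space M"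
  using L2_space_add[OF assms(1) L2_space_cmult[OF assms(2), of "-1"]] by simp

lemma L2_space_zero: "(\<lambda>x. 0) \<in> L2_space M"
  by (simp add: L2_space_def)

lemma L2_space_sum:
  assumes "\<And>i. i \<in> A \<Longrightarrow> u i \<in> L2_space M"
  shows "(\<lambda>x. \<Sum>i\<in>A. u i x) \<in> L2_space M"
  using assms
  by (induction A rule: infinite_finite_induct) (auto simp: L2_space_zero L2_space_add)

lemma L2_norm_nonneg [simp]: "0 \<le> L2_norm M u"
  by (simp add: L2_norm_def integral_nonneg_AE)

lemma L2_norm_sq: "(L2_norm M u)\<^sup>2 = (LINT x|M. (cmod (u x))\<^sup>2)"
  by (simp add: L2_norm_def integral_nonneg_AE)

lemma L2_norm_cong_AE:
  assumes "u \<in> borel_measurable M" "v \<in> borel_measurable M" "AE x in M. u x = v x"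
  shows "L2_norm M u = L2_norm M v"
  unfolding L2_norm_def using assms by (intro arg_cong[of _ _ sqrt] integral_cong_AE) auto

lemma L2_norm_cmult: "L2_norm M (\<lambda>x. c * u x) = cmod c * L2_norm M u"
  by (simp add: L2_norm_def norm_mult power_mult_distrib real_sqrt_mult)

lemma L2_norm_minus_commute: "L2_norm M (\<lambda>x. u x - v x) = L2_norm M (\<lambda>x. v x - u x)"
  by (simp add: L2_norm_def norm_minus_commute)

lemma L2_norm_eq_0D:
  assumes "u \<in> L2_space M" "L2_norm M u = 0"
  shows "AE x in M. u x = 0"
proof -
  have "(LINT x|M. (cmod (u x))\<^sup>2) = 0"
    using assms(2) L2_norm_sq[of M u] by simp
  then show ?thesis
    using integral_nonneg_eq_0_iff_AE[OF L2_spaceD(2)[OF assms(1)]] by simp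
qed

lemma L2_mult_integrable:
  assumes "u \<in> L2_space M" "v \<in> L2_space M"
  shows "integrable M (\<lambda>x. u x * v x)"
proof (rule Bochner_Integration.integrable_bound)
  show "integrable M (\<lambda>x. (cmod (u x))\<^sup>2 + (cmod (v x))\<^sup>2)"
    using assms[THEN L2_spaceD(2)] by simp
  have "p * q \<le> p\<^sup>2 + q\<^sup>2" if "0 \<le> p" "0 \<le> q" for p q :: real
    using zero_le_power2[of "p - q"] mult_nonneg_nonneg[OF that]
    by (simp add: power2_diff)
  then show "AE x in M. norm (u x * v x) \<le> norm ((cmod (u x))\<^sup>2 + (cmod (v x))\<^sup>2)"
    by (simp add: norm_mult)
qed (use assms[THEN L2_spaceD(1)] in auto)

text \<open>
  Optimising the weighted inequality \<open>2pq \<le> s p\<^sup>2 + q\<^sup>2 / s\<close> over \<open>s > 0\<close> gives the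
  Cauchy--Schwarz inequality without dividing by a norm that may vanish.
\<close>

lemma L2_Cauchy_Schwarz_abs:
  assumes "u \<in> L2_space M" "v \<in> L2_space M"
  shows "(LINT x|M. cmod (u x) * cmod (v x)) \<le> L2_norm M u * L2_norm M v"
proof -
  let ?A = "L2_norm M u" and ?B = "L2_norm M v" and ?X = "LINT x|M. cmod (u x) * cmod (v x)"
  have int: "integrable M (\<lambda>x. cmod (u x) * cmod (v x))"
    using L2_mult_integrable[OF assms, THEN integrable_norm] by (simp add: norm_mult)
  have weighted: "2 * ?X \<le> s * ?A\<^sup>2 + ?B\<^sup>2 / s" if "s > 0" for s
  proof -
    have *: "2 * (p * q) \<le> s * p\<^sup>2 + q\<^sup>2 / s" for p q :: real
    proof -
      have "s * p\<^sup>2 + q\<^sup>2 / s - 2 * (p * q) = (s * p - q)\<^sup>2 / s"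
        using that by (simp add: field_simps power2_eq_square)
      also have "\<dots> \<ge> 0" using that by simp
      finally show ?thesis by simp
    qed
    have "2 * ?X = (LINT x|M. 2 * (cmod (u x) * cmod (v x)))"
      by simp
    also have "\<dots> \<le> (LINT x|M. s * (cmod (u x))\<^sup>2 + (cmod (v x))\<^sup>2 / s)"
      using int assms[THEN L2_spaceD(2)] * by (intro integral_mono) auto
    also have "\<dots> = s * ?A\<^sup>2 + ?B\<^sup>2 / s"
      using assms[THEN L2_spaceD(2)] by (simp add: L2_norm_sq)
    finally show ?thesis .
  qed
  have eps: "?X \<le> (?A + e) * (?B + e)" if "e > 0" for e
  proof -
    let ?a = "?A + e" and ?b = "?B + e"
    have ab: "?a > 0" "?b > 0" using that L2_norm_nonneg[of M u] L2_norm_nonneg[of M v] by linarith+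
    have "2 * ?X \<le> (?b / ?a) * ?A\<^sup>2 + ?B\<^sup>2 / (?b / ?a)"
      using ab by (intro weighted) simp
    also have "\<dots> \<le> (?b / ?a) * ?a\<^sup>2 + ?b\<^sup>2 / (?b / ?a)"
      using ab that by (intro add_mono mult_left_mono divide_right_mono power_mono) auto
    also have "\<dots> = 2 * (?a * ?b)"
      using ab(1)[THEN less_imp_neq] ab(2)[THEN less_imp_neq]
      by (simp add: power2_eq_square)
    finally show ?thesis by simp
  qed
  have "((\<lambda>e. (?A + e) * (?B + e)) \<longlongrightarrow> (?A + 0) * (?B + 0)) (at_right 0)"
    by (intro tendsto_intros)
  then have "?X \<le> (?A + 0) * (?B + 0)"
  proof (rule tendsto_lowerbound)
    show "\<forall>\<^sub>F e in at_right 0. ?X \<le> (?A + e) * (?B + e)"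
      by (rule eventually_mono[OF eventually_at_right_less[of 0]]) (rule eps)
  qed simp
  then show ?thesis by simp
qed

lemma L2_Cauchy_Schwarz:
  assumes "u \<in> L2_space M" "v \<in> L2_space M"
  shows "cmod (LINT x|M. u x * v x) \<le> L2_norm M u * L2_norm M v"
proof -
  have "cmod (LINT x|M. u x * v x) \<le> (LINT x|M. cmod (u x * v x))"
    by (rule integral_norm_bound)
  then show ?thesis
    using L2_Cauchy_Schwarz_abs[OF assms] by (simp add: norm_mult)
qed

lemma L2_norm_triangle:
  assumes "u \<in> L2_space M" "v \<in> L2_space M"
  shows "L2_norm M (\<lambda>x. u x + v x) \<le> L2_norm M u + L2_norm M v"
proof (rule power2_le_imp_le)
  have int: "integrable M (\<lambda>x. cmod (u x) * cmod (v x))"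
    using L2_mult_integrable[OF assms, THEN integrable_norm] by (simp add: norm_mult)
  have "(cmod (u x + v x))\<^sup>2 \<le> (cmod (u x))\<^sup>2 + 2 * (cmod (u x) * cmod (v x)) + (cmod (v x))\<^sup>2" for x
    using power_mono[OF norm_triangle_ineq[of "u x" "v x"], of 2] by (simp add: power2_sum)
  then have "(L2_norm M (\<lambda>x. u x + v x))\<^sup>2 \<le>
      (LINT x|M. (cmod (u x))\<^sup>2 + 2 * (cmod (u x) * cmod (v x)) + (cmod (v x))\<^sup>2)"
    unfolding L2_norm_sq using int assms[THEN L2_spaceD(2)] L2_space_add[OF assms, THEN L2_spaceD(2)]
    by (intro integral_mono) auto
  also have "\<dots> = (L2_norm M u)\<^sup>2 + 2 * (LINT x|M. cmod (u x) * cmod (v x)) + (L2_norm M v)\<^sup>2"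
    using int assms[THEN L2_spaceD(2)] by (simp add: L2_norm_sq)
  also have "\<dots> \<le> (L2_norm M u + L2_norm M v)\<^sup>2"
    using L2_Cauchy_Schwarz_abs[OF assms] by (simp add: power2_sum)
  finally show "(L2_norm M (\<lambda>x. u x + v x))\<^sup>2 \<le> (L2_norm M u + L2_norm M v)\<^sup>2" .
qed simp

lemma L2_norm_triangle_diff:
  assumes "u \<in> L2_space M" "v \<in> L2_space M"
  shows "L2_norm M u \<le> L2_norm M v + L2_norm M (\<lambda>x. u x - v x)"
  using L2_norm_triangle[OF assms(2) L2_space_diff[OF assms]] by simp

lemma L2_norm_sum:
  assumes "\<And>i. i \<in> A \<Longrightarrow> u i \<in> L2_space M"
  shows "L2_norm M (\<lambda>x. \<Sum>i\<in>A. u i x) \<le> (\<Sum>i\<in>A. L2_norm M (u i))"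
  using assms
proof (induction A rule: infinite_finite_induct)
  case (insert i A)
  have "L2_norm M (\<lambda>x. u i x + (\<Sum>i\<in>A. u i x)) \<le> L2_norm M (u i) + L2_norm M (\<lambda>x. \<Sum>i\<in>A. u i x)"
    using insert.prems by (intro L2_norm_triangle L2_space_sum) auto
  then show ?case using insert by fastforce
qed (auto simp: L2_norm_def)

lemma L2_norm_tendsto:
  assumes "\<And>n. u n \<in> L2_space M" "v \<in> L2_space M"
    and "(\<lambda>n. L2_norm M (\<lambda>x. u n x - v x)) \<longlonglongrightarrow> 0"
  shows "(\<lambda>n. L2_norm M (u n)) \<longlonglongrightarrow> L2_norm M v"
proof (rule LIM_zero_cancel, rule tendsto_rabs_zero_cancel, rule tendsto_sandwich[OF _ _ tendsto_const assms(3)])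
  show "\<forall>\<^sub>F n in sequentially. \<bar>L2_norm M (u n) - L2_norm M v\<bar> \<le> L2_norm M (\<lambda>x. u n x - v x)"
    using L2_norm_triangle_diff[OF assms(1,2)] L2_norm_triangle_diff[OF assms(2,1)]
    by (auto simp: abs_le_iff L2_norm_minus_commute[of M v] algebra_simps)
qed auto

text \<open>
  Completeness of \<open>L\<^sup>2\<close>, in the form in which it is needed: an absolutely convergent series
  converges.  On a finite measure space \<open>L\<^sup>2\<close>-norms dominate \<open>L\<^sup>1\<close>-norms, so the series of
  moduli has a finite integral and converges almost everywhere; Fatou's lemma transfers the
  norm bounds from the partial sums to the limit.
\<close>

lemma L2_series_converges:
  assumes "finite_measure M" and v: "\<And>n. v n \<in> L2_space M"
    and sums: "summable (\<lambda>n. L2_norm M (v n))"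
  obtains w where "w \<in> L2_space M"
    "\<And>N. L2_norm M (\<lambda>x. w x - (\<Sum>n<N. v n x)) \<le> (\<Sum>n. L2_norm M (v (n + N)))"
proof -
  interpret finite_measure M by fact
  have one: "(\<lambda>x. 1) \<in> L2_space M" by (simp add: L2_space_def)
  have meas [measurable]: "v n \<in> borel_measurable M" for n
    using v by (rule L2_spaceD)
  have int1: "integrable M (\<lambda>x. cmod (v n x))" for n
    using L2_mult_integrable[OF v one, of n] by (simp add: integrable_norm)
  have le: "(LINT x|M. cmod (v n x)) \<le> L2_norm M (v n) * L2_norm M (\<lambda>x. 1)" for n
    using L2_Cauchy_Schwarz_abs[OF v one, of n] by simp
  have sum1: "summable (\<lambda>n. LINT x|M. cmod (v n x))"
    by (rule summable_comparison_test'[OF summable_mult2[OF sums, of "L2_norm M (\<lambda>x. 1)"]])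
      (use le in \<open>auto simp: integral_nonneg_AE\<close>)
  have "(\<integral>\<^sup>+x. (\<Sum>n. ennreal (cmod (v n x))) \<partial>M) = (\<Sum>n. \<integral>\<^sup>+x. ennreal (cmod (v n x)) \<partial>M)"
    by (rule nn_integral_suminf) simp
  also have "\<dots> = (\<Sum>n. ennreal (LINT x|M. cmod (v n x)))"
    using int1 by (simp add: nn_integral_eq_integral)
  also have "\<dots> = ennreal (\<Sum>n. LINT x|M. cmod (v n x))"
    by (rule suminf_ennreal2) (auto simp: sum1 integral_nonneg_AE)
  finally have "AE x in M. (\<Sum>n. ennreal (cmod (v n x))) \<noteq> \<infinity>"
    by (intro nn_integral_PInf_AE) auto
  then have AEs: "AE x in M. summable (\<lambda>n. v n x)"
  proof eventually_elim
    case (elim x)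
    then have "summable (\<lambda>n. cmod (v n x))"
      by (intro summable_suminf_not_top) (auto simp: infinity_ennreal_def)
    then show ?case by (rule summable_norm_cancel)
  qed
  have sums': "summable (\<lambda>n. L2_norm M (v (n + N)))" for N
    using sums by (rule summable_ignore_initial_segment)
  define w where "w = (\<lambda>x. \<Sum>n. v n x)"
  have wm [measurable]: "w \<in> borel_measurable M"
    unfolding w_def by measurable
  have fat: "integrable M (\<lambda>x. (cmod (w x - (\<Sum>n<N. v n x)))\<^sup>2) \<and>
     (LINT x|M. (cmod (w x - (\<Sum>n<N. v n x)))\<^sup>2) \<le> (\<Sum>n. L2_norm M (v (n + N)))\<^sup>2" for N
  proof (rule integrable_Fatou)
    fix m
    have L: "(\<lambda>x. \<Sum>n<m. v (n + N) x) \<in> L2_space M"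
      using v by (intro L2_space_sum) auto
    then show "integrable M (\<lambda>x. (cmod (\<Sum>n<m. v (n + N) x))\<^sup>2)"
      by (rule L2_spaceD)
    have "L2_norm M (\<lambda>x. \<Sum>n<m. v (n + N) x) \<le> (\<Sum>n<m. L2_norm M (v (n + N)))"
      using v by (intro L2_norm_sum) auto
    also have "\<dots> \<le> (\<Sum>n. L2_norm M (v (n + N)))"
      using sums' by (intro sum_le_suminf) auto
    finally show "(LINT x|M. (cmod (\<Sum>n<m. v (n + N) x))\<^sup>2) \<le> (\<Sum>n. L2_norm M (v (n + N)))\<^sup>2"
      unfolding L2_norm_sq[symmetric] by (intro power_mono) auto
  next
    show "AE x in M. (\<lambda>m. (cmod (\<Sum>n<m. v (n + N) x))\<^sup>2) \<longlonglongrightarrow> (cmod (w x - (\<Sum>n<N. v n x)))\<^sup>2"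
      using AEs
    proof eventually_elim
      case (elim x)
      have "(\<lambda>n. v (n + N) x) sums (w x - (\<Sum>n<N. v n x))"
        unfolding w_def by (rule sums_split_initial_segment) (use elim in \<open>simp add: summable_sums\<close>)
      then show ?case
        unfolding sums_def by (intro tendsto_intros)
    qed
  qed auto
  show thesis
  proof
    show "w \<in> L2_space M"
      using fat[of 0] by (simp add: L2_space_def)
    show "L2_norm M (\<lambda>x. w x - (\<Sum>n<N. v n x)) \<le> (\<Sum>n. L2_norm M (v (n + N)))" for N
      by (rule power2_le_imp_le) (use fat[of N] sums' in \<open>auto simp: L2_norm_sq intro!: suminf_nonneg\<close>)
  qed
qed

section \<open>Local boundedness of strongly continuous semigroups\<close>

lemma L2_norm_additive_op:
  assumes T: "\<And>u. u \<in> L2_space M \<Longrightarrow> T u \<in> L2_space M"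
    and lin: "\<And>u v c. u \<in> L2_space M \<Longrightarrow> v \<in> L2_space M \<Longrightarrow>
          AE x in M. T (\<lambda>y. u y + c * v y) x = T u x + c * T v x"
    and u: "u \<in> L2_space M" and v: "v \<in> L2_space M"
  shows "L2_norm M (T (\<lambda>y. u y + c * v y)) = L2_norm M (\<lambda>x. T u x + c * T v x)"
    by (intro L2_norm_cong_AE lin u v L2_spaceD(1)[OF T] L2_spaceD(1)[OF L2_space_add] L2_space_add L2_space_cmult T)

lemma L2_near_optimal_vector:
  assumes bdd: "\<exists>C. \<forall>u\<in>L2_space M. L2_norm M (T u) \<le> C * L2_norm M u"
    and big: "\<not> (\<forall>u\<in>L2_space M. L2_norm M (T u) \<le> B * L2_norm M u)" and "B > 0"
    and hom: "\<And>u c. u \<in> L2_space M \<Longrightarrow> L2_norm M (T (\<lambda>x. c * u x)) = cmod c * L2_norm M (T u)"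
  obtains K y where "B \<le> K" "y \<in> L2_space M" "L2_norm M y \<le> 1" "3/4 * K \<le> L2_norm M (T y)"
    "\<And>u. u \<in> L2_space M \<Longrightarrow> L2_norm M (T u) \<le> K * L2_norm M u"
proof -
  obtain C where C: "\<And>u. u \<in> L2_space M \<Longrightarrow> L2_norm M (T u) \<le> C * L2_norm M u"
    using bdd by auto
  define X where "X = {L2_norm M (T u) | u. u \<in> L2_space M \<and> L2_norm M u \<le> 1}"
  define K where "K = Sup X"
  have bX: "bdd_above X"
  proof (rule bdd_aboveI)
    fix r assume "r \<in> X"
    then obtain u where u: "u \<in> L2_space M" "L2_norm M u \<le> 1" "r = L2_norm M (T u)"
      by (auto simp: X_def)
    have "C * L2_norm M u \<le> \<bar>C\<bar> * 1"
      using u(2) by (intro mult_mono) auto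
    then show "r \<le> \<bar>C\<bar>" using C[OF u(1)] u(3) by simp
  qed
  have K: "L2_norm M (T u) \<le> K * L2_norm M u" if u: "u \<in> L2_space M" for u
  proof (cases "L2_norm M u = 0")
    case True
    then show ?thesis using C[OF u] by simp
  next
    case False
    then have pos: "L2_norm M u > 0" using L2_norm_nonneg[of M u] by linarith
    let ?c = "of_real (1 / L2_norm M u) :: complex"
    have "L2_norm M (\<lambda>x. ?c * u x) \<le> 1"
      unfolding L2_norm_cmult using pos by (simp add: norm_divide)
    then have "L2_norm M (T (\<lambda>x. ?c * u x)) \<in> X"
      unfolding X_def using u by (intro CollectI exI[of _ "\<lambda>x. ?c * u x"] conjI refl L2_space_cmult)
    then have "L2_norm M (T (\<lambda>x. ?c * u x)) \<le> K"
      unfolding K_def by (rule cSup_upper) (rule bX)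
    then have "cmod ?c * L2_norm M (T u) \<le> K"
      unfolding hom[OF u] .
    then show ?thesis
      using pos by (simp add: norm_divide field_simps)
  qed
  have "B \<le> K"
  proof (rule ccontr)
    assume "\<not> B \<le> K"
    then have "K * L2_norm M u \<le> B * L2_norm M u" for u
      by (intro mult_right_mono) auto
    then show False using big K order_trans by blast
  qed
  then have "3/4 * K < Sup X" using \<open>B > 0\<close> by (simp add: K_def)
  moreover have "X \<noteq> {}"
    unfolding X_def using L2_space_zero[of M]
    by (auto intro!: exI[of _ "\<lambda>x. 0"] simp: L2_norm_def)
  ultimately obtain r where "r \<in> X" "3/4 * K < r"
    using less_cSup_iff[OF _ bX] by blast
  then obtain y where "y \<in> L2_space M" "L2_norm M y \<le> 1" "3/4 * K \<le> L2_norm M (T y)"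
    by (auto simp: X_def)
  then show thesis using that K \<open>B \<le> K\<close> by blast
qed

text \<open>
  The uniform boundedness principle.  If the norms were unbounded, some sequence of operators would
  have norms \<open>K\<^sub>n \<ge> 4\<^sup>n\<close>.  From \<open>x\<close>, one of the two points \<open>x \<plusminus> 3\<^sup>-\<^sup>n y\<close> is sent by the \<open>n\<close>-th operator to
  a vector of norm at least \<open>3\<^sup>-\<^sup>n \<parallel>T\<^sub>n y\<parallel>\<close>, because the images differ by twice \<open>3\<^sup>-\<^sup>n T\<^sub>n y\<close>.
  Walking along these choices with near-optimal \<open>y\<close> produces a convergent sequence, and all later
  steps together are too short (at most half of \<open>3\<^sup>-\<^sup>n\<close>) to undo the growth gained in step \<open>n\<close>.
\<close>

lemma L2_uniform_boundedness:
  fixes T :: "nat \<Rightarrow> ('a \<Rightarrow> complex) \<Rightarrow> 'a \<Rightarrow> complex"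
  assumes fin: "finite_measure M"
    and T: "\<And>n u. u \<in> L2_space M \<Longrightarrow> T n u \<in> L2_space M"
    and lin: "\<And>n u v c. u \<in> L2_space M \<Longrightarrow> v \<in> L2_space M \<Longrightarrow>
          AE x in M. T n (\<lambda>y. u y + c * v y) x = T n u x + c * T n v x"
    and bdd: "\<And>n. \<exists>C. \<forall>u\<in>L2_space M. L2_norm M (T n u) \<le> C * L2_norm M u"
    and orbit: "\<And>u. u \<in> L2_space M \<Longrightarrow> \<exists>B. \<forall>n. L2_norm M (T n u) \<le> B"
  shows "\<exists>C. \<forall>n. \<forall>u\<in>L2_space M. L2_norm M (T n u) \<le> C * L2_norm M u"
proof (rule ccontr)
  assume neg: "\<not> ?thesis"
  have add: "L2_norm M (T n (\<lambda>y. u y + c * v y)) = L2_norm M (\<lambda>x. T n u x + c * T n v x)"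
    if "u \<in> L2_space M" "v \<in> L2_space M" for n u v c
    by (rule L2_norm_additive_op[of M "T n"]) (simp_all add: T lin that)
  have T0: "L2_norm M (T n (\<lambda>x. 0)) = 0" for n
  proof -
    obtain C where "\<forall>u\<in>L2_space M. L2_norm M (T n u) \<le> C * L2_norm M u"
      using bdd by blast
    then have "L2_norm M (T n (\<lambda>x. 0)) \<le> C * L2_norm M (\<lambda>x. 0)"
      using L2_space_zero by blast
    then show ?thesis
      using L2_norm_nonneg[of M "T n (\<lambda>x. 0)"] by (simp add: L2_norm_def[of M "\<lambda>x. 0"])
  qed
  have hom: "L2_norm M (T n (\<lambda>x. c * u x)) = cmod c * L2_norm M (T n u)" if u: "u \<in> L2_space M" for n u c
  proof -
    have "AE x in M. T n (\<lambda>x. 0) x = 0"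
      by (rule L2_norm_eq_0D[OF T[OF L2_space_zero] T0])
    then have "AE x in M. T n (\<lambda>y. 0) x + c * T n u x = c * T n u x"
      by eventually_elim simp
    then have "L2_norm M (\<lambda>x. T n (\<lambda>y. 0) x + c * T n u x) = L2_norm M (\<lambda>x. c * T n u x)"
      by (intro L2_norm_cong_AE L2_spaceD(1)[of _ M] L2_space_add L2_space_cmult T L2_space_zero u)
    then show ?thesis
      using add[OF L2_space_zero u, of n c] by (simp add: L2_norm_cmult)
  qed
  have "\<exists>k K y. 4 ^ n \<le> K \<and> y \<in> L2_space M \<and> L2_norm M y \<le> 1 \<and> 3/4 * K \<le> L2_norm M (T k y) \<and>
     (\<forall>u\<in>L2_space M. L2_norm M (T k u) \<le> K * L2_norm M u)" for n :: nat
  proof -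
    obtain k where k: "\<not> (\<forall>u\<in>L2_space M. L2_norm M (T k u) \<le> 4 ^ n * L2_norm M u)"
      using neg by blast
    show ?thesis
    proof (rule L2_near_optimal_vector[OF bdd k _ hom])
      fix K y
      assume "4 ^ n \<le> K" "y \<in> L2_space M" "L2_norm M y \<le> 1" "3/4 * K \<le> L2_norm M (T k y)"
        "\<And>u. u \<in> L2_space M \<Longrightarrow> L2_norm M (T k u) \<le> K * L2_norm M u"
      then show ?thesis by blast
    qed auto
  qed
  then obtain k K y where K4: "\<And>n. 4 ^ n \<le> K n" and y: "\<And>n. y n \<in> L2_space M"
    and y1: "\<And>n. L2_norm M (y n) \<le> 1" and yK: "\<And>n. 3/4 * K n \<le> L2_norm M (T (k n) (y n))"
    and K: "\<And>n u. u \<in> L2_space M \<Longrightarrow> L2_norm M (T (k n) u) \<le> K n * L2_norm M u"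
    by metis
  define r :: "nat \<Rightarrow> complex" where "r n = of_real ((1/3) ^ n)" for n
  have cr: "cmod (r n) = (1/3) ^ n" for n by (simp add: r_def norm_power norm_divide)
  \<comment> \<open>the sign of the \<open>n\<close>-th step, chosen according to the point \<open>x\<close> reached so far\<close>
  define s where "s n x = (if cmod (r n) * L2_norm M (T (k n) (y n)) \<le> L2_norm M (T (k n) (\<lambda>z. x z + r n * y n z))
      then r n else - r n)" for n x
  define x where "x = rec_nat (\<lambda>z. 0) (\<lambda>n x z. x z + s n x * y n z)"
  have x0: "x 0 = (\<lambda>z. 0)" and xS: "x (Suc n) = (\<lambda>z. x n z + s n (x n) * y n z)" for n
    by (simp_all add: x_def)
  have xL: "x n \<in> L2_space M" for n
    by (induction n) (simp_all add: x0 xS L2_space_zero L2_space_add L2_space_cmult y)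
  have cs: "cmod (s n u) = (1/3) ^ n" for n u
    by (simp add: s_def cr)
  have grow: "(1/3) ^ n * L2_norm M (T (k n) (y n)) \<le> L2_norm M (T (k n) (x (Suc n)))" for n
  proof (cases "cmod (r n) * L2_norm M (T (k n) (y n)) \<le> L2_norm M (T (k n) (\<lambda>z. x n z + r n * y n z))")
    case True
    then show ?thesis by (simp add: xS s_def cr)
  next
    case False
    let ?p = "\<lambda>z. T (k n) (x n) z + r n * T (k n) (y n) z" and ?q = "\<lambda>z. T (k n) (x n) z + (- r n) * T (k n) (y n) z"
    have pq: "?p \<in> L2_space M" "?q \<in> L2_space M"
      by (intro L2_space_add L2_space_cmult T xL y)+
    have "2 * (cmod (r n) * L2_norm M (T (k n) (y n))) = L2_norm M (\<lambda>z. ?p z - ?q z)"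
      using L2_norm_cmult[of M "2 * r n" "T (k n) (y n)"] by (simp add: norm_mult algebra_simps)
    also have "\<dots> \<le> L2_norm M ?p + L2_norm M ?q"
      using L2_norm_triangle[OF pq(1) L2_space_cmult[OF pq(2), of "-1"]] L2_norm_cmult[of M "-1" ?q] by simp
    also have "\<dots> = L2_norm M (T (k n) (\<lambda>z. x n z + r n * y n z)) + L2_norm M (T (k n) (\<lambda>z. x n z + (- r n) * y n z))"
      by (simp only: add[OF xL y])
    finally have "cmod (r n) * L2_norm M (T (k n) (y n)) \<le> L2_norm M (T (k n) (\<lambda>z. x n z + (- r n) * y n z))"
      using False by linarith
    then show ?thesis using False by (simp add: xS s_def cr)
  qed
  define v where "v n = (\<lambda>z. s n (x n) * y n z)" for n
  have vL: "v n \<in> L2_space M" for n by (simp add: v_def L2_space_cmult y)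
  have vn: "L2_norm M (v n) \<le> (1/3) ^ n" for n
    using y1[of n] by (simp add: v_def L2_norm_cmult cs mult_left_le)
  have geo: "summable (\<lambda>n. (1/3 :: real) ^ n)" by (simp add: summable_geometric)
  have vs: "summable (\<lambda>n. L2_norm M (v n))"
    by (rule summable_comparison_test'[OF geo]) (use vn in auto)
  obtain w where w: "w \<in> L2_space M"
    and tail: "\<And>N. L2_norm M (\<lambda>z. w z - (\<Sum>n<N. v n z)) \<le> (\<Sum>n. L2_norm M (v (n + N)))"
    using L2_series_converges[OF fin vL vs] by blast
  have xsum: "x N = (\<lambda>z. \<Sum>n<N. v n z)" for N
    by (induction N) (auto simp: x0 xS v_def)
  have close: "L2_norm M (\<lambda>z. w z - x (Suc n) z) \<le> 1/2 * (1/3) ^ n" for n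
  proof -
    have "L2_norm M (\<lambda>z. w z - x (Suc n) z) \<le> (\<Sum>j. L2_norm M (v (j + Suc n)))"
      using tail[of "Suc n"] by (simp add: xsum)
    also have "\<dots> \<le> (\<Sum>j. (1/3) ^ j * (1/3) ^ Suc n)"
      using vn[of "_ + Suc n"]
      by (intro suminf_le summable_ignore_initial_segment[OF vs] summable_mult2 geo) (simp add: power_add)
    also have "\<dots> = 1/2 * (1/3) ^ n"
      using suminf_mult2[OF geo, of "(1/3) ^ Suc n"] by (simp add: suminf_geometric)
    finally show ?thesis .
  qed
  have big: "1/4 * (4/3) ^ n \<le> L2_norm M (T (k n) w)" for n
  proof -
    let ?d = "\<lambda>z. x (Suc n) z - w z"
    have dL: "?d \<in> L2_space M" by (intro L2_space_diff xL w)
    have "L2_norm M (T (k n) (x (Suc n))) \<le> L2_norm M (T (k n) w) + L2_norm M (T (k n) ?d)"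
      using add[OF w dL, of "k n" 1] L2_norm_triangle[OF T[OF w, of "k n"] T[OF dL, of "k n"]] by simp
    moreover have "L2_norm M (T (k n) ?d) \<le> 1/2 * ((1/3) ^ n * K n)"
    proof -
      have "0 \<le> K n" using K4[of n] by (meson order_trans zero_le_power zero_le_numeral)
      then have "K n * L2_norm M ?d \<le> K n * (1/2 * (1/3) ^ n)"
        using close[of n] by (intro mult_left_mono) (auto simp: L2_norm_minus_commute[of M "x (Suc n)" w])
      then show ?thesis using K[OF dL, of n] by (simp add: mult_ac)
    qed
    moreover have "3/4 * ((1/3) ^ n * K n) \<le> (1/3) ^ n * L2_norm M (T (k n) (y n))"
      using mult_left_mono[OF yK[of n], of "(1/3) ^ n"] by (simp add: mult_ac)
    moreover have "(4/3) ^ n \<le> (1/3) ^ n * K n"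
      using mult_left_mono[OF K4[of n], of "(1/3) ^ n"] by (simp add: power_divide)
    ultimately show ?thesis
      using grow[of n] by linarith
  qed
  obtain B where B: "\<And>n. L2_norm M (T n w) \<le> B" using orbit[OF w] by auto
  obtain n where "4 * B < (4/3 :: real) ^ n"
    using real_arch_pow[of "4/3" "4 * B"] by auto
  then show False using big[of n] B[of "k n"] by simp
qed

text \<open>
  Norms unbounded near time zero would be unbounded along some sequence \<open>t\<^sub>n \<rightarrow> 0\<close>; but every orbit
  converges along that sequence, so it is bounded and the uniform boundedness principle applies.
\<close>

lemma C0_semigroup_locally_bounded:
  assumes fin: "finite_measure M" and S: "C0_semigroup M S"
  obtains \<delta> C where "\<delta> > 0" "\<And>t u. 0 \<le> t \<Longrightarrow> t \<le> \<delta> \<Longrightarrow> u \<in> L2_space M \<Longrightarrow> L2_norm M (S t u) \<le> C * L2_norm M u"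
proof -
  have "\<exists>\<delta>>0. \<exists>C. \<forall>t. 0 \<le> t \<and> t \<le> \<delta> \<longrightarrow> (\<forall>u\<in>L2_space M. L2_norm M (S t u) \<le> C * L2_norm M u)"
  proof (rule ccontr)
    assume neg: "\<not> ?thesis"
    have "\<exists>t. 0 \<le> t \<and> t \<le> 1 / real (Suc n) \<and>
        \<not> (\<forall>u\<in>L2_space M. L2_norm M (S t u) \<le> (1 + real n) * L2_norm M u)" for n
      using neg by (metis of_nat_0_less_iff zero_less_Suc zero_less_divide_1_iff)
    then obtain t where t: "\<And>n. 0 \<le> t n" "\<And>n. t n \<le> 1 / real (Suc n)"
      and tbig: "\<And>n. \<not> (\<forall>u\<in>L2_space M. L2_norm M (S (t n) u) \<le> (1 + real n) * L2_norm M u)"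
      by metis
    have SL: "S (t n) u \<in> L2_space M" if "u \<in> L2_space M" for n u
      using S t that by (simp add: C0_semigroup_def)
    have tpos: "0 < t n" for n
    proof (rule ccontr)
      assume "\<not> 0 < t n"
      then have t0: "t n = 0" using t(1)[of n] by linarith
      have "L2_norm M (S (t n) u) \<le> (1 + real n) * L2_norm M u" if u: "u \<in> L2_space M" for u
      proof -
        have "L2_norm M (S (t n) u) = L2_norm M u"
          using S u SL[OF u, of n] unfolding t0
          by (intro L2_norm_cong_AE) (auto simp: C0_semigroup_def dest: L2_spaceD)
        then show ?thesis by (simp add: algebra_simps)
      qed
      then show False using tbig[of n] by blast
    qed
    have t0: "t \<longlonglongrightarrow> 0"
      by (rule tendsto_sandwich[OF _ _ tendsto_const lim_inverse_n'[THEN LIMSEQ_Suc]]) (use t in auto)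
    have filt: "filterlim t (at_right 0) sequentially"
      unfolding filterlim_at using t0 tpos by (auto simp: less_imp_neq[OF tpos, symmetric])
    have "\<exists>C. \<forall>n. \<forall>u\<in>L2_space M. L2_norm M (S (t n) u) \<le> C * L2_norm M u"
    proof (rule L2_uniform_boundedness[OF fin, of "\<lambda>n. S (t n)"])
      fix u assume u: "u \<in> L2_space M"
      then have "((\<lambda>t. L2_norm M (\<lambda>x. S t u x - u x)) \<longlongrightarrow> 0) (at_right 0)"
        using S by (simp add: C0_semigroup_def)
      then have "(\<lambda>n. L2_norm M (\<lambda>x. S (t n) u x - u x)) \<longlonglongrightarrow> 0"
        by (rule filterlim_compose[OF _ filt])
      then have "(\<lambda>n. L2_norm M (S (t n) u)) \<longlonglongrightarrow> L2_norm M u"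
        by (rule L2_norm_tendsto[OF SL[OF u] u])
      then have "Bseq (\<lambda>n. L2_norm M (S (t n) u))"
        by (rule convergent_imp_Bseq[OF convergentI])
      then show "\<exists>B. \<forall>n. L2_norm M (S (t n) u) \<le> B"
        by (auto simp: Bseq_def)
    qed (use S t in \<open>auto simp: C0_semigroup_def\<close>)
    then obtain C where C: "\<And>n u. u \<in> L2_space M \<Longrightarrow> L2_norm M (S (t n) u) \<le> C * L2_norm M u"
      by blast
    obtain n where n: "C < real n" using reals_Archimedean2 by blast
    have "C * L2_norm M u \<le> (1 + real n) * L2_norm M u" for u
      using n by (intro mult_right_mono) auto
    then show False using tbig[of n] C order_trans by blast
  qed
  then show thesis using that by blast
qed

section \<open>Characters of the periodic box\<close>

locale periodic_box =
  fixes a b :: "real ^ 'n"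
  assumes ab: "\<And>i. a $ i < b $ i"
begin

abbreviation "M \<equiv> box_measure a b"

definition vol :: real where "vol = measure M (space M)"

definition freq :: "int ^ 'n \<Rightarrow> 'n \<Rightarrow> real" where
  "freq k i = 2 * pi * of_int (k $ i) / (b $ i - a $ i)"

definition phase :: "int ^ 'n \<Rightarrow> real ^ 'n \<Rightarrow> real" where
  "phase k x = (\<Sum>i\<in>UNIV. freq k i * (x $ i - a $ i))"

definition character :: "int ^ 'n \<Rightarrow> real ^ 'n \<Rightarrow> complex" where
  "character k x = exp (\<i> * of_real (phase k x))"

definition periodic_in :: "'n \<Rightarrow> (real ^ 'n \<Rightarrow> complex) \<Rightarrow> bool" where
  "periodic_in i F \<longleftrightarrow> (\<forall>x. F (x + (b $ i - a $ i) *\<^sub>R axis i 1) = F x)"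

lemma finite_M: "finite_measure M"
  by (rule finite_measure_lebesgue_on) (simp add: lmeasurable_box)

sublocale finite_measure M by (rule finite_M)

lemma continuous_integrable_M:
  fixes F :: "real ^ 'n \<Rightarrow> complex"
  assumes "continuous_on UNIV F"
  shows "integrable M F"
proof -
  have "F absolutely_integrable_on cbox a b"
    by (rule absolutely_integrable_continuous) (use assms continuous_on_subset in blast)
  then have "F absolutely_integrable_on box a b"
    by (rule set_integrable_subset) (auto simp: box_subset_cbox)
  then show ?thesis
    by (simp add: set_integrable_def integrable_restrict_space)
qed

lemma integral_M_eq:
  fixes F :: "real ^ 'n \<Rightarrow> complex"
  assumes "continuous_on UNIV F"
  shows "(LINT x|M. F x) = integral (cbox a b) F"
  using lebesgue_integral_eq_integral[OF continuous_integrable_M[OF assms]]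
  by (simp add: integral_open_interval)

lemma vol_pos: "vol > 0"
proof -
  have "complex_of_real vol = (LINT x|M. 1)"
    by (simp add: vol_def scaleR_conv_of_real)
  also have "\<dots> = integral (cbox a b) (\<lambda>x. 1)"
    by (rule integral_M_eq) simp
  finally have "complex_of_real vol = of_real (measure lborel (cbox a b))"
    by (simp add: scaleR_conv_of_real)
  then have "vol = measure lborel (cbox a b)"
    by (simp only: of_real_eq_iff)
  then show ?thesis
    using ab by (auto intro!: content_pos_lt simp: Basis_vec_def inner_axis)
qed

lemma continuous_L2:
  fixes F :: "real ^ 'n \<Rightarrow> complex"
  assumes "continuous_on UNIV F"
  shows "F \<in> L2_space M"
proof -
  have "integrable M (\<lambda>x. F x * cnj (F x))"
    by (rule continuous_integrable_M) (intro continuous_intros assms)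
  then have "integrable M (\<lambda>x. Re (F x * cnj (F x)))"
    by (rule integrable_Re)
  then show ?thesis
    using borel_measurable_integrable[OF continuous_integrable_M[OF assms]]
    by (simp add: L2_space_def complex_mult_cnj cmod_power2)
qed

text \<open>
  Translating a period cell along an axis cuts a slab off one face and adds its translate by a full
  period at the opposite face.
\<close>

lemma integral_translated_cell:
  fixes F :: "real ^ 'n \<Rightarrow> complex"
  assumes cont: "continuous_on UNIV F" and per: "periodic_in i F"
    and h: "0 \<le> h" "h \<le> b $ i - a $ i"
  shows "integral (cbox a b) (\<lambda>x. F (x + h *\<^sub>R axis i 1)) = integral (cbox a b) F"
proof -
  let ?e = "axis i 1 :: real ^ 'n" and ?L = "b $ i - a $ i"
  have int: "F integrable_on cbox c d" for c d
    by (rule integrable_continuous) (use cont continuous_on_subset in blast)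
  have shift: "integral (cbox c d) (\<lambda>x. F (x + v)) = integral (cbox (c + v) (d + v)) F" for c d v
  proof -
    have "(F has_integral integral (cbox (c + v) (d + v)) F) (cbox (c + v) (d + v))"
      using int by (rule integrable_integral)
    then have "((F \<circ> (+) v) has_integral integral (cbox (c + v) (d + v)) F) (cbox c d)"
      by (simp only: has_integral_shift_cbox_iff)
    then show ?thesis by (simp add: o_def add.commute integral_unique)
  qed
  have split: "integral (cbox c d) F = integral (cbox c (\<chi> j. if j = i then min (d $ i) s else d $ j)) F
      + integral (cbox (\<chi> j. if j = i then max (c $ i) s else c $ j) d) F" for c d s
  proof -
    have "(F has_integral integral (cbox c d \<inter> {x. x \<bullet> ?e \<le> s}) F + integral (cbox c d \<inter> {x. x \<bullet> ?e \<ge> s}) F) (cbox c d)"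
      by (rule has_integral_split[where k = "?e" and c = s])
        (auto intro!: integrable_integral simp: interval_split axis_in_Basis_iff int)
    moreover have "cbox c d \<inter> {x. x \<bullet> ?e \<le> s} = cbox c (\<chi> j. if j = i then min (d $ i) s else d $ j)"
      "cbox c d \<inter> {x. x \<bullet> ?e \<ge> s} = cbox (\<chi> j. if j = i then max (c $ i) s else c $ j) d"
      by (auto simp: set_eq_iff mem_box_cart inner_axis split: if_splits)
    ultimately show ?thesis by (simp add: integral_unique)
  qed
  let ?h = "h *\<^sub>R ?e"
  have "integral (cbox a b) (\<lambda>x. F (x + h *\<^sub>R ?e)) = integral (cbox (a + ?h) (b + ?h)) F"
    by (rule shift)
  also have "\<dots> = integral (cbox (a + ?h) b) F + integral (cbox (a + ?L *\<^sub>R ?e) (b + ?h)) F"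
  proof -
    have "(\<chi> j. if j = i then min ((b + ?h) $ i) (b $ i) else (b + ?h) $ j) = b"
      "(\<chi> j. if j = i then max ((a + ?h) $ i) (b $ i) else (a + ?h) $ j) = a + ?L *\<^sub>R ?e"
      using h by (auto simp: vec_eq_iff axis_def)
    then show ?thesis using split[of "a + ?h" "b + ?h" "b $ i"] by simp
  qed
  also have "integral (cbox (a + ?L *\<^sub>R ?e) (b + ?h)) F = integral (cbox a (b + (h - ?L) *\<^sub>R ?e)) F"
  proof -
    have "b + ?h = (b + (h - ?L) *\<^sub>R ?e) + ?L *\<^sub>R ?e"
      by (simp add: algebra_simps)
    then have "integral (cbox (a + ?L *\<^sub>R ?e) (b + ?h)) F = integral (cbox a (b + (h - ?L) *\<^sub>R ?e)) (\<lambda>x. F (x + ?L *\<^sub>R ?e))"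
      by (simp only: shift)
    also have "\<dots> = integral (cbox a (b + (h - ?L) *\<^sub>R ?e)) F"
      using per by (simp add: periodic_in_def)
    finally show ?thesis .
  qed
  also have "integral (cbox (a + ?h) b) F + integral (cbox a (b + (h - ?L) *\<^sub>R ?e)) F = integral (cbox a b) F"
  proof -
    have "(\<chi> j. if j = i then min (b $ i) (a $ i + h) else b $ j) = b + (h - ?L) *\<^sub>R ?e"
      "(\<chi> j. if j = i then max (a $ i) (a $ i + h) else a $ j) = a + ?h"
      using h by (auto simp: vec_eq_iff axis_def)
    then show ?thesis using split[of a b "a $ i + h"] by simp
  qed
  finally show ?thesis .
qed

text \<open>
  The divergence theorem on the torus: the translation-invariant integral of a periodic function does
  not depend on the translation, so differentiating it under the integral sign gives zero.
\<close>

lemma integral_partial_deriv_periodic: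
  fixes F :: "real ^ 'n \<Rightarrow> complex"
  assumes diff: "\<And>x. F differentiable (at x)" and cont: "continuous_on UNIV (partial_deriv i F)"
    and per: "periodic_in i F"
  shows "(LINT x|M. partial_deriv i F x) = 0"
proof -
  let ?e = "axis i 1 :: real ^ 'n" and ?L = "b $ i - a $ i"
  have contF: "continuous_on UNIV F"
    using diff by (simp add: differentiable_imp_continuous_on differentiable_on_def)
  have der: "((\<lambda>t. F (x + t *\<^sub>R ?e)) has_vector_derivative partial_deriv i F (x + t *\<^sub>R ?e)) (at t within {0..?L})" for x t
  proof -
    have "(F has_derivative frechet_derivative F (at (x + t *\<^sub>R ?e))) (at (x + t *\<^sub>R ?e))"
      using diff frechet_derivative_works by blast
    moreover have "((\<lambda>t. x + t *\<^sub>R ?e) has_derivative (\<lambda>s. s *\<^sub>R ?e)) (at t within {0..?L})"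
      by (auto intro!: derivative_eq_intros)
    ultimately have "((\<lambda>t. F (x + t *\<^sub>R ?e)) has_derivative (\<lambda>s. frechet_derivative F (at (x + t *\<^sub>R ?e)) (s *\<^sub>R ?e))) (at t within {0..?L})"
      by (rule has_derivative_compose[rotated])
    moreover have "frechet_derivative F (at (x + t *\<^sub>R ?e)) (s *\<^sub>R ?e) = s *\<^sub>R partial_deriv i F (x + t *\<^sub>R ?e)" for s
      unfolding partial_deriv_def
      by (rule linear_cmul[OF linear_frechet_derivative[OF diff]])
    ultimately show ?thesis by (simp add: has_vector_derivative_def)
  qed
  have "((\<lambda>t. integral (cbox a b) (\<lambda>x. F (x + t *\<^sub>R ?e))) has_vector_derivative
      integral (cbox a b) (\<lambda>x. partial_deriv i F (x + 0 *\<^sub>R ?e))) (at 0 within {0..?L})"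
  proof (rule leibniz_rule_vector_derivative[where fx = "\<lambda>t x. partial_deriv i F (x + t *\<^sub>R ?e)"])
    show "(\<lambda>x. F (x + t *\<^sub>R ?e)) integrable_on cbox a b" for t
      by (intro integrable_continuous continuous_on_compose2[OF contF] continuous_intros) auto
    show "continuous_on ({0..?L} \<times> cbox a b) (\<lambda>(t, x). partial_deriv i F (x + t *\<^sub>R ?e))"
      unfolding case_prod_unfold
      by (intro continuous_on_compose2[OF cont] continuous_intros) auto
  qed (use der ab[of i] in auto)
  moreover have "((\<lambda>t. integral (cbox a b) (\<lambda>x. F (x + t *\<^sub>R ?e))) has_vector_derivative 0) (at 0 within {0..?L})"
    by (rule has_vector_derivative_transform[OF _ _ has_vector_derivative_const[of "integral (cbox a b) F"]])
      (use ab[of i] integral_translated_cell[OF contF per] in auto)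
  moreover have "at 0 within {0..?L} \<noteq> bot"
    using ab[of i] by (simp add: at_within_Icc_at_right trivial_limit_at_right_real)
  ultimately have "integral (cbox a b) (\<lambda>x. partial_deriv i F (x + 0 *\<^sub>R ?e)) = 0"
    by (metis vector_derivative_unique_within)
  then show ?thesis
    by (simp add: integral_M_eq[OF cont])
qed

lemma phase_add: "phase (k + l) x = phase k x + phase l x"
  by (simp add: phase_def freq_def sum.distrib[symmetric] algebra_simps add_divide_distrib)

lemma phase_minus: "phase (- k) x = - phase k x"
  by (simp add: phase_def freq_def sum_negf)

lemma character_add: "character (k + l) x = character k x * character l x"
  by (simp add: character_def phase_add exp_add algebra_simps)

lemma character_minus: "character (- k) x = cnj (character k x)"
  by (simp add: character_def phase_minus exp_cnj)

lemma character_0 [simp]: "character 0 x = 1"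
  by (simp add: character_def phase_def freq_def)

lemma norm_character [simp]: "cmod (character k x) = 1"
  by (simp add: character_def norm_exp_i_times)

lemma character_has_derivative:
  "(character k has_derivative (\<lambda>h. \<i> * of_real (\<Sum>i\<in>UNIV. freq k i * h $ i) * character k x)) (at x)"
proof -
  have "(phase k has_derivative (\<lambda>h. \<Sum>i\<in>UNIV. freq k i * h $ i)) (at x)"
    unfolding phase_def
    by (auto intro!: derivative_eq_intros bounded_linear_imp_has_derivative bounded_linear_vec_nth)
  then have "((\<lambda>x. \<i> * complex_of_real (phase k x)) has_derivative (\<lambda>h. \<i> * of_real (\<Sum>i\<in>UNIV. freq k i * h $ i))) (at x)"
    by (intro has_derivative_mult_right has_derivative_of_real)
  moreover have "(exp has_derivative (\<lambda>h. exp z * h)) (at z)" for z :: complex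
    using DERIV_exp[of z] by (simp add: has_field_derivative_def)
  ultimately have "((\<lambda>x. exp (\<i> * complex_of_real (phase k x))) has_derivative
     (\<lambda>h. exp (\<i> * complex_of_real (phase k x)) * (\<i> * of_real (\<Sum>i\<in>UNIV. freq k i * h $ i)))) (at x)"
    by (rule has_derivative_compose)
  then show ?thesis
    unfolding character_def[abs_def] by (simp add: mult_ac)
qed

lemma partial_deriv_character:
  "partial_deriv i (\<lambda>x. c * character k x) = (\<lambda>x. (c * (\<i> * of_real (freq k i))) * character k x)"
proof
  fix x
  have "((\<lambda>x. c * character k x) has_derivative (\<lambda>h. c * (\<i> * of_real (\<Sum>i\<in>UNIV. freq k i * h $ i) * character k x))) (at x)"
    by (intro has_derivative_mult_right character_has_derivative)
  then have "frechet_derivative (\<lambda>x. c * character k x) (at x) = (\<lambda>h. c * (\<i> * of_real (\<Sum>i\<in>UNIV. freq k i * h $ i) * character k x))"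
    by (rule frechet_derivative_at[symmetric])
  moreover have "(\<Sum>j\<in>UNIV. freq k j * (axis i 1 :: real ^ 'n) $ j) = freq k i"
    by (simp add: axis_def if_distrib cong: if_cong)
  ultimately show "partial_deriv i (\<lambda>x. c * character k x) x = (c * (\<i> * of_real (freq k i))) * character k x"
    by (simp add: partial_deriv_def mult_ac del: of_real_sum of_real_mult)
qed

lemma character_differentiable: "(\<lambda>x. c * character k x) differentiable (at x)"
  using has_derivative_mult_right[OF character_has_derivative, of c] by (auto simp: differentiable_def)

lemma continuous_character: "continuous_on A (character k)"
  using character_differentiable[of 1 k]
  by (simp add: differentiable_imp_continuous_on differentiable_on_def differentiable_at_withinI)

lemma C_k_character: "C_k m (\<lambda>x. c * character k x)"
proof (induction m arbitrary: c)
  case 0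
  then show ?case by (simp add: continuous_character continuous_on_mult_left)
next
  case (Suc m)
  then show ?case
    using character_differentiable[of 1 k] by (simp add: partial_deriv_character)
qed

lemma periodic_in_character: "periodic_in i (character k)"
  unfolding periodic_in_def
proof
  fix x
  have "phase k (x + (b $ i - a $ i) *\<^sub>R axis i 1) - phase k x = (\<Sum>j\<in>UNIV. if j = i then freq k i * (b $ i - a $ i) else 0)"
    unfolding phase_def sum_subtractf[symmetric]
    by (intro sum.cong) (auto simp: axis_def algebra_simps)
  also have "\<dots> = 2 * pi * of_int (k $ i)"
    using ab[of i] by (simp add: freq_def)
  finally have *: "phase k (x + (b $ i - a $ i) *\<^sub>R axis i 1) = phase k x + 2 * pi * of_int (k $ i)"
    by simp
  have "exp (\<i> * complex_of_real (2 * pi * of_int (k $ i))) = 1"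
    using exp_integer_2pi[of "of_int (k $ i)"] by (simp add: mult_ac)
  then show "character k (x + (b $ i - a $ i) *\<^sub>R axis i 1) = character k x"
    by (simp add: character_def * distrib_left exp_add del: of_real_mult)
qed

lemma character_periodic_test: "character k \<in> periodic_test a b"
  using C_k_character[of _ 1 k] periodic_in_character[of _ k]
  by (auto simp: periodic_test_def periodic_in_def)

lemma character_L2: "character k \<in> L2_space M"
  by (rule continuous_L2) (rule continuous_character)

text \<open>
  A character with a nonzero frequency is a multiple of its own partial derivative in that direction.
\<close>

lemma integral_character: "(LINT x|M. character k x) = (if k = 0 then of_real vol else 0)"
proof (cases "k = 0")
  case True
  then show ?thesis by (simp add: vol_def scaleR_conv_of_real)
next
  case False
  then obtain i where i: "k $ i \<noteq> 0" by (auto simp: vec_eq_iff)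
  have "(LINT x|M. partial_deriv i (character k) x) = 0"
    using partial_deriv_character[of i 1 k] character_differentiable[of 1 k]
    by (intro integral_partial_deriv_periodic periodic_in_character)
      (auto intro!: continuous_intros continuous_character)
  then have "\<i> * of_real (freq k i) * (LINT x|M. character k x) = 0"
    using partial_deriv_character[of i 1 k] by simp
  then show ?thesis
    using i False ab[of i] by (simp add: freq_def)
qed

text \<open>
  Integration by parts: the product of a character with a test function is periodic, so its partial
  derivative integrates to zero.
\<close>

lemma weak_partial_character: "weak_partial a b i (\<lambda>x. c * character k x) (\<lambda>x. (c * (\<i> * of_real (freq k i))) * character k x)"
  unfolding weak_partial_def
proof (intro conjI ballI L2_space_cmult character_L2)
  fix \<psi> assume "\<psi> \<in> periodic_test a b"
  then have C: "C_k (Suc 0) \<psi>" and per: "\<psi> (x + (b $ i - a $ i) *\<^sub>R axis i 1) = \<psi> x" for x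
    by (auto simp: periodic_test_def)
  then have d: "\<psi> differentiable (at x)" and cd: "continuous_on UNIV (partial_deriv i \<psi>)" for x
    by auto
  have cont: "continuous_on UNIV \<psi>"
    using d by (simp add: differentiable_imp_continuous_on differentiable_on_def)
  let ?u = "\<lambda>x. c * character k x" and ?g = "\<lambda>x. (c * (\<i> * of_real (freq k i))) * character k x"
  have pd: "partial_deriv i (\<lambda>x. ?u x * \<psi> x) = (\<lambda>x. ?u x * partial_deriv i \<psi> x + ?g x * \<psi> x)"
  proof
    fix x
    have "((\<lambda>x. ?u x * \<psi> x) has_derivative (\<lambda>h. ?u x * frechet_derivative \<psi> (at x) h + frechet_derivative ?u (at x) h * \<psi> x)) (at x)"
      using d character_differentiable frechet_derivative_works by (intro has_derivative_mult) blast+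
    then have "frechet_derivative (\<lambda>x. ?u x * \<psi> x) (at x) = (\<lambda>h. ?u x * frechet_derivative \<psi> (at x) h + frechet_derivative ?u (at x) h * \<psi> x)"
      by (rule frechet_derivative_at[symmetric])
    moreover have "frechet_derivative ?u (at x) (axis i 1) = ?g x"
      using fun_cong[OF partial_deriv_character[of i c k], of x] by (simp add: partial_deriv_def)
    ultimately show "partial_deriv i (\<lambda>x. ?u x * \<psi> x) x = ?u x * partial_deriv i \<psi> x + ?g x * \<psi> x"
      by (simp add: partial_deriv_def)
  qed
  have c1: "continuous_on UNIV (\<lambda>x. ?u x * partial_deriv i \<psi> x)" "continuous_on UNIV (\<lambda>x. ?g x * \<psi> x)"
    by (intro continuous_intros continuous_character cd cont)+
  have "(LINT x|M. partial_deriv i (\<lambda>x. ?u x * \<psi> x) x) = 0"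
  proof (rule integral_partial_deriv_periodic)
    show "(\<lambda>x. ?u x * \<psi> x) differentiable (at x)" for x
      using d character_differentiable by (intro differentiable_mult) auto
    show "continuous_on UNIV (partial_deriv i (\<lambda>x. ?u x * \<psi> x))"
      unfolding pd using c1 by (rule continuous_on_add)
    show "periodic_in i (\<lambda>x. ?u x * \<psi> x)"
      using per periodic_in_character[of i k] by (simp add: periodic_in_def)
  qed
  then show "(LINT x|M. ?u x * partial_deriv i \<psi> x) = - (LINT x|M. ?g x * \<psi> x)"
    unfolding pd using c1[THEN continuous_integrable_M]
    by (simp add: eq_neg_iff_add_eq_0)
qed

end

section \<open>Completeness of the characters\<close>

context periodic_box
begin

inductive trig_poly :: "(real ^ 'n \<Rightarrow> complex) \<Rightarrow> bool" where
  trig_poly_character: "trig_poly (\<lambda>x. c * character k x)"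
| trig_poly_add: "trig_poly p \<Longrightarrow> trig_poly q \<Longrightarrow> trig_poly (\<lambda>x. p x + q x)"

lemma trig_poly_const: "trig_poly (\<lambda>x. c)"
  using trig_poly_character[of c 0] by simp

lemma trig_poly_cmult: "trig_poly p \<Longrightarrow> trig_poly (\<lambda>x. c * p x)"
proof (induction rule: trig_poly.induct)
  case (trig_poly_character d k)
  then show ?case using trig_poly.trig_poly_character[of "c * d" k] by (simp add: mult.assoc)
next
  case (trig_poly_add p q)
  then show ?case using trig_poly.trig_poly_add by (simp add: distrib_left)
qed

lemma trig_poly_mult: "trig_poly p \<Longrightarrow> trig_poly q \<Longrightarrow> trig_poly (\<lambda>x. p x * q x)"
proof (induction rule: trig_poly.induct)
  case (trig_poly_character c k)
  from \<open>trig_poly q\<close> have "trig_poly (\<lambda>x. character k x * q x)"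
  proof (induction rule: trig_poly.induct)
    case (trig_poly_character d l)
    then show ?case
      using trig_poly.trig_poly_character[of d "k + l"] by (simp add: character_add mult_ac)
  next
    case (trig_poly_add p q)
    then show ?case using trig_poly.trig_poly_add by (simp add: distrib_left)
  qed
  then show ?case using trig_poly_cmult[of "\<lambda>x. character k x * q x" c] by (simp add: mult.assoc)
next
  case (trig_poly_add p p')
  then show ?case using trig_poly.trig_poly_add by (simp add: distrib_right)
qed

lemma trig_poly_sum: "(\<And>i. i \<in> A \<Longrightarrow> trig_poly (p i)) \<Longrightarrow> trig_poly (\<lambda>x. \<Sum>i\<in>A. p i x)"
  by (induction A rule: infinite_finite_induct) (simp_all add: trig_poly_const trig_poly_add)

lemma trig_poly_continuous: "trig_poly p \<Longrightarrow> continuous_on UNIV p"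
  by (induction rule: trig_poly.induct) (auto intro!: continuous_intros continuous_character)

lemma integrable_mult_continuous:
  fixes F :: "real ^ 'n \<Rightarrow> complex"
  assumes g: "integrable M g" and F: "continuous_on UNIV F"
  shows "integrable M (\<lambda>x. g x * F x)"
proof -
  have "bounded (F ` cbox a b)"
    using F by (intro compact_imp_bounded compact_continuous_image) (auto intro: continuous_on_subset)
  then obtain C where C: "\<And>x. x \<in> cbox a b \<Longrightarrow> cmod (F x) \<le> C"
    by (auto simp: bounded_iff)
  show ?thesis
  proof (rule Bochner_Integration.integrable_bound)
    show "integrable M (\<lambda>x. C * cmod (g x))"
      using g by (intro integrable_mult_right integrable_norm)
    show "(\<lambda>x. g x * F x) \<in> borel_measurable M"
      using g borel_measurable_integrable[OF continuous_integrable_M[OF F]] by auto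
    show "AE x in M. norm (g x * F x) \<le> norm (C * cmod (g x))"
    proof (rule AE_I2)
      fix x assume "x \<in> space M"
      then have "x \<in> cbox a b" using box_subset_cbox[of a b] by auto
      then have "cmod (F x) \<le> \<bar>C\<bar>" using C[of x] by linarith
      then show "norm (g x * F x) \<le> norm (C * cmod (g x))"
        using mult_right_mono[of "cmod (F x)" "\<bar>C\<bar>" "cmod (g x)"] by (simp add: norm_mult abs_mult mult.commute)
    qed
  qed
qed

text \<open>
  The box is wrapped onto the torus of \<open>n\<close>-tuples of unit complex numbers.  The torus is compact, so
  that the Stone--Weierstrass theorem applies there, and functions on it are automatically periodic
  on the box.
\<close>

definition torus_map :: "real ^ 'n \<Rightarrow> complex ^ 'n" where
  "torus_map x = (\<chi> j. character (axis j 1) x)"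

lemma continuous_torus_map: "continuous_on A torus_map"
  unfolding torus_map_def[abs_def] by (intro continuous_on_vec_lambda continuous_character)

lemma torus_map_inj:
  assumes x: "x \<in> box a b" and y: "y \<in> box a b" and eq: "torus_map x = torus_map y"
  shows "x = y"
proof -
  have "x $ i = y $ i" for i
  proof -
    let ?L = "b $ i - a $ i" and ?k = "axis i 1 :: int ^ 'n"
    have ph: "phase ?k z = 2 * pi / ?L * (z $ i - a $ i)" for z
    proof -
      have "phase ?k z = (\<Sum>j\<in>UNIV. if j = i then 2 * pi / ?L * (z $ i - a $ i) else 0)"
        unfolding phase_def freq_def by (intro sum.cong) (auto simp: axis_def)
      then show ?thesis by simp
    qed
    have "character ?k x = character ?k y"
      using eq by (auto simp: torus_map_def vec_eq_iff)
    then obtain m :: int where "\<i> * of_real (phase ?k x) = \<i> * of_real (phase ?k y) + of_int (2 * m) * pi * \<i>"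
      unfolding character_def exp_eq by blast
    then have "\<i> * complex_of_real (phase ?k x) = \<i> * complex_of_real (phase ?k y + of_int (2 * m) * pi)"
      by (simp add: algebra_simps)
    then have "phase ?k x = phase ?k y + of_int (2 * m) * pi"
      by (simp only: mult_cancel_left of_real_eq_iff) simp
    then have "2 * pi / ?L * (x $ i - a $ i) - 2 * pi / ?L * (y $ i - a $ i) = 2 * pi * of_int m"
      unfolding ph by simp
    then have "2 * pi / ?L * (x $ i - y $ i) = 2 * pi * of_int m"
      unfolding right_diff_distrib[symmetric] by simp
    then have "2 * pi * ((x $ i - y $ i) / ?L) = 2 * pi * of_int m"
      by simp
    then have "(x $ i - y $ i) / ?L = of_int m"
      by (simp only: mult_cancel_left) simp
    then have *: "x $ i - y $ i = ?L * of_int m"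
      using ab[of i] by (simp add: field_simps)
    have lt: "\<bar>x $ i - y $ i\<bar> < ?L"
      using x y by (auto simp: mem_box_cart abs_less_iff) (smt (verit))+
    have "m = 0"
    proof (rule ccontr)
      assume "m \<noteq> 0"
      then have "1 \<le> \<bar>real_of_int m\<bar>" by linarith
      then have "?L * 1 \<le> ?L * \<bar>real_of_int m\<bar>"
        using ab[of i] by (intro mult_left_mono) auto
      then show False using lt ab[of i] by (simp add: * abs_mult)
    qed
    then show ?thesis using * by simp
  qed
  then show ?thesis by (simp add: vec_eq_iff)
qed

text \<open>
  A real-linear function of a complex coordinate combines its real and imaginary parts, and these are
  combinations of a character and its conjugate, which is the character of the opposite frequency.
\<close>

lemma trig_poly_real_polynomial:
  assumes "real_polynomial_function q"
  shows "trig_poly (\<lambda>x. of_real (q (torus_map x)))"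
  using assms
proof (induction rule: real_polynomial_function.induct)
  case (linear f)
  interpret f: bounded_linear f by fact
  have f: "f z = (\<Sum>j\<in>UNIV. Re (z $ j) * f (axis j 1) + Im (z $ j) * f (axis j \<i>))" for z :: "complex ^ 'n"
  proof -
    have "axis j w = Re w *\<^sub>R axis j 1 + Im w *\<^sub>R (axis j \<i> :: complex ^ 'n)" for j :: 'n and w
      by (simp add: vec_eq_iff axis_def complex_eq_iff)
    then have axis: "f (axis j w) = Re w * f (axis j 1) + Im w * f (axis j \<i>)" for j :: 'n and w
      by (metis f.add f.scaleR real_scaleR_def)
    have "z = (\<Sum>j\<in>UNIV. axis j (z $ j))"
      by (simp add: vec_eq_iff axis_def sum.delta' if_distrib cong: if_cong)
    then have "f z = (\<Sum>j\<in>UNIV. f (axis j (z $ j)))"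
      using f.sum[of "\<lambda>j. axis j (z $ j)" UNIV] by simp
    then show ?thesis
      by (simp only: axis[of _ "z $ _"])
  qed
  have Re: "complex_of_real (Re (character k x)) = 1/2 * character k x + 1/2 * character (- k) x"
    and Im: "complex_of_real (Im (character k x)) = - \<i>/2 * character k x + \<i>/2 * character (- k) x" for k x
    by (simp_all add: character_minus complex_eq_iff)
  let ?p = "\<lambda>x. \<Sum>j\<in>UNIV. of_real (f (axis j 1)) * (1/2 * character (axis j 1) x + 1/2 * character (- axis j 1) x)
      + of_real (f (axis j \<i>)) * (- \<i>/2 * character (axis j 1) x + \<i>/2 * character (- axis j 1) x)"
  have "trig_poly ?p"
    by (intro trig_poly_sum trig_poly_add trig_poly_cmult trig_poly_character)
  moreover have "of_real (f (torus_map x)) = ?p x" for x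
    by (subst f) (simp only: torus_map_def of_real_sum of_real_add of_real_mult vec_lambda_beta Re Im mult.commute)
  ultimately show ?case by simp
next
  case (const c)
  then show ?case by (rule trig_poly_const)
next
  case (add f g)
  then show ?case using trig_poly_add by simp
next
  case (mult f g)
  then show ?case using trig_poly_mult by simp
qed

context
  fixes g :: "real ^ 'n \<Rightarrow> complex"
  assumes g: "integrable M g" and ortho: "\<And>k. (LINT x|M. g x * character k x) = 0"
begin

lemma integral_mult_trig_poly_eq_0: "trig_poly p \<Longrightarrow> (LINT x|M. g x * p x) = 0"
proof (induction rule: trig_poly.induct)
  case (trig_poly_character c k)
  have "(LINT x|M. g x * (c * character k x)) = c * (LINT x|M. g x * character k x)"
    by (simp add: mult.left_commute)
  then show ?case by (simp add: ortho)
next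
  case (trig_poly_add p q)
  then show ?case
    by (simp add: distrib_left integrable_mult_continuous[OF g] trig_poly_continuous)
qed

text \<open>
  Polynomials in the real and imaginary parts of the torus coordinates are trigonometric polynomials,
  and they are uniformly dense in the continuous functions on the torus.
\<close>

lemma integral_mult_torus_function_eq_0:
  fixes f :: "complex ^ 'n \<Rightarrow> real"
  assumes f: "continuous_on UNIV f"
  shows "(LINT x|M. g x * of_real (f (torus_map x))) = 0"
proof -
  let ?I = "LINT x|M. g x * of_real (f (torus_map x))" and ?B = "LINT x|M. cmod (g x)"
  have cont: "continuous_on UNIV (\<lambda>x. complex_of_real (f (torus_map x)))"
    by (intro continuous_on_of_real continuous_on_compose2[OF f] continuous_torus_map) auto
  have "cmod ?I \<le> e * ?B" if "e > 0" for e
  proof -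
    have K: "compact (torus_map ` cbox a b)"
      by (intro compact_continuous_image continuous_torus_map compact_cbox)
    have fK: "continuous_on (torus_map ` cbox a b) f"
      using f by (rule continuous_on_subset) simp
    obtain q where q: "real_polynomial_function q"
      and close: "\<And>z. z \<in> torus_map ` cbox a b \<Longrightarrow> \<bar>f z - q z\<bar> < e"
      by (rule Stone_Weierstrass_real_polynomial_function[OF K fK \<open>e > 0\<close>]) (rule that, assumption, blast)
    let ?q = "\<lambda>x. complex_of_real (q (torus_map x))"
    have tq: "trig_poly ?q" by (rule trig_poly_real_polynomial[OF q])
    have int: "integrable M (\<lambda>x. g x * of_real (f (torus_map x)))" "integrable M (\<lambda>x. g x * ?q x)"
      using integrable_mult_continuous[OF g] cont trig_poly_continuous[OF tq] by auto
    have "?I = (LINT x|M. g x * of_real (f (torus_map x)) - g x * ?q x)"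
      using int integral_mult_trig_poly_eq_0[OF tq] by simp
    also have "cmod \<dots> \<le> (LINT x|M. e * cmod (g x))"
    proof (rule order_trans[OF integral_norm_bound integral_mono])
      show "integrable M (\<lambda>x. norm (g x * of_real (f (torus_map x)) - g x * ?q x))"
        using int by (intro integrable_norm Bochner_Integration.integrable_diff)
      show "integrable M (\<lambda>x. e * cmod (g x))"
        using g by (intro integrable_mult_right integrable_norm)
      fix x assume "x \<in> space M"
      then have "x \<in> cbox a b" using box_subset_cbox[of a b] by auto
      then have "\<bar>f (torus_map x) - q (torus_map x)\<bar> \<le> e" using close by (simp add: less_imp_le)
      moreover have "norm (g x * of_real (f (torus_map x)) - g x * ?q x) = cmod (g x) * \<bar>f (torus_map x) - q (torus_map x)\<bar>"
        unfolding right_diff_distrib[symmetric] norm_mult of_real_diff[symmetric] norm_of_real ..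
      ultimately show "norm (g x * of_real (f (torus_map x)) - g x * ?q x) \<le> e * cmod (g x)"
        using mult_right_mono[of "\<bar>f (torus_map x) - q (torus_map x)\<bar>" e "cmod (g x)"]
        by (simp add: mult.commute)
    qed
    also have "\<dots> = e * ?B" by simp
    finally show ?thesis .
  qed
  then have ev: "\<forall>\<^sub>F e in at_right 0. cmod ?I \<le> e * ?B"
    by (intro eventually_mono[OF eventually_at_right_less[of 0]])
  have "((\<lambda>e. e * ?B) \<longlongrightarrow> 0 * ?B) (at_right 0)"
    by (intro tendsto_intros)
  from tendsto_lowerbound[OF this ev] show ?thesis by simp
qed

text \<open>
  The indicator of a closed cube \<open>Q\<close> inside the open box is a limit of continuous torus functions:
  the torus map is injective on the open box, so a point lies in \<open>Q\<close> exactly if its image has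
  distance zero from the compact image of \<open>Q\<close>.
\<close>

lemma integral_subcell_eq_0:
  assumes sub: "cbox c d \<subseteq> box a b"
  shows "integral (cbox c d) g = 0"
proof (cases "cbox c d = {}")
  case False
  define C where "C = torus_map ` cbox c d"
  have C: "closed C" "C \<noteq> {}"
    using False unfolding C_def
    by (auto intro!: compact_imp_closed compact_continuous_image continuous_torus_map)
  have memC: "torus_map x \<in> C \<longleftrightarrow> x \<in> cbox c d" if "x \<in> box a b" for x
    using torus_map_inj[OF that] sub by (auto simp: C_def)
  define f where "f m z = max 0 (1 - real m * infdist z C)" for m z
  have f01: "0 \<le> f m z" "f m z \<le> 1" for m z
    by (auto simp: f_def infdist_nonneg)
  have contf: "continuous_on UNIV (f m)" for m
    unfolding f_def[abs_def] by (intro continuous_intros)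
  have flim: "(\<lambda>m. f m z) \<longlonglongrightarrow> indicator C z" for z
  proof (cases "z \<in> C")
    case True
    then show ?thesis by (simp add: f_def)
  next
    case False
    then have pos: "infdist z C > 0"
      using in_closed_iff_infdist_zero[OF C] infdist_nonneg[of z C] by (metis less_eq_real_def)
    obtain N where N: "1 < real N * infdist z C"
      using reals_Archimedean3[OF pos] by blast
    have "f m z = 0" if "N \<le> m" for m
    proof -
      have "real N * infdist z C \<le> real m * infdist z C"
        using that pos by (intro mult_right_mono) auto
      then show ?thesis using N by (simp add: f_def)
    qed
    then have "\<forall>\<^sub>F m in sequentially. f m z = indicator C z"
      using False unfolding eventually_sequentially by auto
    then show ?thesis by (rule tendsto_eventually)
  qed
  let ?h = "\<lambda>x. g x * of_real (indicat_real (cbox c d) x)"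
  have meas: "(\<lambda>x. g x * complex_of_real (f m (torus_map x))) \<in> borel_measurable M" for m
  proof (rule borel_measurable_integrable[OF integrable_mult_continuous[OF g]])
    show "continuous_on UNIV (\<lambda>x. complex_of_real (f m (torus_map x)))"
      by (intro continuous_on_of_real continuous_on_compose2[OF contf] continuous_torus_map) auto
  qed
  have hm: "?h \<in> borel_measurable M"
  proof -
    have "cbox c d \<in> sets M" using sub by (simp add: sets_restrict_space_iff)
    then show ?thesis using g by measurable
  qed
  have ptw: "AE x in M. (\<lambda>m. g x * complex_of_real (f m (torus_map x))) \<longlonglongrightarrow> ?h x"
  proof (rule AE_I2)
    fix x assume "x \<in> space M"
    then have "indicator C (torus_map x) = indicat_real (cbox c d) x"
      using memC[of x] by (auto simp: indicator_def)
    then show "(\<lambda>m. g x * complex_of_real (f m (torus_map x))) \<longlonglongrightarrow> ?h x"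
      using flim[of "torus_map x"] by (intro tendsto_intros) auto
  qed
  have dom: "AE x in M. norm (g x * complex_of_real (f m (torus_map x))) \<le> cmod (g x)" for m
    using f01 by (auto simp: norm_mult intro!: mult_left_le)
  have ng: "integrable M (\<lambda>x. cmod (g x))" using g by (rule integrable_norm)
  have "(\<lambda>m. LINT x|M. g x * complex_of_real (f m (torus_map x))) \<longlonglongrightarrow> (LINT x|M. ?h x)"
    by (rule integral_dominated_convergence[OF hm meas ng ptw dom])
  then have I0: "(LINT x|M. ?h x) = 0"
    using integral_mult_torus_function_eq_0[OF contf] by (simp add: LIMSEQ_const_iff)
  have "integrable M ?h"
    by (rule integrable_dominated_convergence[OF hm meas ng ptw dom])
  then have "(?h has_integral 0) (box a b)"
    using has_integral_integral_lebesgue_on[of "box a b" ?h] I0 by simp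
  moreover have "?h = (\<lambda>x. if x \<in> cbox c d then g x else 0)"
    by (auto simp: indicator_def)
  ultimately have "(g has_integral 0) (cbox c d)"
    using has_integral_restrict[OF sub, of g 0] by simp
  then show ?thesis by (rule integral_unique)
qed simp

text \<open>
  By Lebesgue's differentiation theorem, almost every value of an integrable function is a limit of
  averages over small cubes, and these averages are zero.
\<close>

lemma AE_eq_0_of_orthogonal: "AE x in M. g x = 0"
proof -
  let ?g = "\<lambda>x. if x \<in> box a b then g x else 0"
  have "integrable lebesgue ?g"
  proof -
    have "?g = (\<lambda>x. indicat_real (box a b) x *\<^sub>R g x)"
      by (auto simp: fun_eq_iff)
    then show ?thesis using g by (simp add: integrable_restrict_space)
  qed
  then have "?g absolutely_integrable_on UNIV"
    by (simp add: set_integrable_def)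
  then have "?g integrable_on UNIV"
    by (simp add: absolutely_integrable_on_def)
  then have int: "?g integrable_on cbox c d" for c d
    by (rule integrable_on_subcbox) simp
  obtain N where N: "negligible N"
    and av: "\<And>x e. x \<notin> N \<Longrightarrow> 0 < e \<Longrightarrow> \<exists>d>0. \<forall>h. 0 < h \<and> h < d \<longrightarrow>
       norm (integral (cbox x (x + h *\<^sub>R One)) ?g /\<^sub>R h ^ DIM(real ^ 'n) - ?g x) < e"
    by (rule integrable_ccontinuous_explicit[OF int]) (rule that, assumption, blast)
  have zero: "g x = 0" if x: "x \<in> box a b" "x \<notin> N" for x
  proof (rule ccontr)
    assume "g x \<noteq> 0"
    then obtain d where "d > 0" and d: "\<And>h. 0 < h \<Longrightarrow> h < d \<Longrightarrow>
       norm (integral (cbox x (x + h *\<^sub>R One)) ?g /\<^sub>R h ^ DIM(real ^ 'n) - ?g x) < cmod (g x)"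
      using av[OF x(2), of "cmod (g x)"] by auto
    define r where "r = Min (range (\<lambda>i. b $ i - x $ i))"
    have r: "r > 0" "r \<le> b $ i - x $ i" for i
      using x by (auto simp: r_def mem_box_cart)
    define h where "h = min d r / 2"
    have h: "0 < h" "h < d" "h < r" using r \<open>d > 0\<close> by (auto simp: h_def)
    have One: "(One :: real ^ 'n) $ i = 1" for i
      by (simp add: cart_eq_inner_axis inner_sum_left inner_Basis axis_in_Basis_iff)
    have sub: "cbox x (x + h *\<^sub>R One) \<subseteq> box a b"
    proof
      fix y assume y: "y \<in> cbox x (x + h *\<^sub>R One)"
      have "a $ i < y $ i \<and> y $ i < b $ i" for i
      proof -
        have "x $ i \<le> y $ i" "y $ i \<le> x $ i + h"
          using y One by (auto simp: mem_box_cart)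
        then show ?thesis using x(1) r(2)[of i] h by (auto simp: mem_box_cart intro: less_le_trans) 
      qed
      then show "y \<in> box a b" by (simp add: mem_box_cart)
    qed
    have "integral (cbox x (x + h *\<^sub>R One)) ?g = integral (cbox x (x + h *\<^sub>R One)) g"
      using sub by (intro integral_cong) auto
    also have "\<dots> = 0" using sub by (rule integral_subcell_eq_0)
    finally show False using d[OF h(1,2)] x(1) by simp
  qed
  have "N \<in> null_sets lebesgue" using N by (simp add: negligible_iff_null_sets)
  then have "AE x in lebesgue. x \<notin> N" by (rule AE_not_in)
  then have "AE x in lebesgue. x \<in> box a b \<longrightarrow> g x = 0"
    by eventually_elim (use zero in blast)
  then show ?thesis by (simp add: AE_restrict_space_iff)
qed

end

end

section \<open>Fourier series in the periodic box\<close>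

context periodic_box
begin

definition freq_cube :: "nat \<Rightarrow> (int ^ 'n) set" where
  "freq_cube N = {k. \<forall>i. \<bar>k $ i\<bar> \<le> int N}"

definition fourier_coeff :: "(real ^ 'n \<Rightarrow> complex) \<Rightarrow> int ^ 'n \<Rightarrow> complex" where
  "fourier_coeff u k = (LINT x|M. u x * cnj (character k x)) / of_real vol"

definition char_sum :: "(int ^ 'n) set \<Rightarrow> (int ^ 'n \<Rightarrow> complex) \<Rightarrow> real ^ 'n \<Rightarrow> complex" where
  "char_sum A c x = (\<Sum>k\<in>A. c k * character k x)"

lemma freq_cube_image: "freq_cube N = vec_lambda ` (PiE UNIV (\<lambda>_. {- int N..int N}))"
proof (intro set_eqI iffI)
  fix k :: "int ^ 'n" assume "k \<in> freq_cube N"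
  then show "k \<in> vec_lambda ` (PiE UNIV (\<lambda>_. {- int N..int N}))"
    by (intro image_eqI[of _ _ "vec_nth k"]) (auto simp: freq_cube_def abs_le_iff minus_le_iff)
next
  fix k :: "int ^ 'n" assume "k \<in> vec_lambda ` (PiE UNIV (\<lambda>_. {- int N..int N}))"
  then show "k \<in> freq_cube N"
    by (auto simp: freq_cube_def abs_le_iff minus_le_iff PiE_def Pi_def)
qed

lemma finite_freq_cube [simp]: "finite (freq_cube N)"
  unfolding freq_cube_image by (intro finite_imageI finite_PiE) auto

lemma card_freq_cube: "card (freq_cube N) \<le> (2 * N + 1) ^ CARD('n)"
proof -
  have "card (freq_cube N) \<le> card (PiE (UNIV :: 'n set) (\<lambda>_. {- int N..int N}))"
    unfolding freq_cube_image by (intro card_image_le finite_PiE) auto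
  also have "\<dots> = (2 * N + 1) ^ CARD('n)"
    by (simp add: card_PiE nat_add_distrib nat_mult_distrib)
  finally show ?thesis .
qed

lemma freq_cube_mono:
  assumes "N \<le> N'"
  shows "freq_cube N \<subseteq> freq_cube N'"
proof -
  have "int N \<le> int N'" using assms by simp
  then show ?thesis
    unfolding freq_cube_def by (auto intro: order_trans[OF _ \<open>int N \<le> int N'\<close>])
qed

lemma ex_freq_cube: "\<exists>N. k \<in> freq_cube N"
proof -
  have "\<bar>k $ i\<bar> \<le> int (nat (\<Sum>j\<in>UNIV. \<bar>k $ j\<bar>))" for i
    using member_le_sum[of i UNIV "\<lambda>j. \<bar>k $ j\<bar>"] by simp
  then show ?thesis unfolding freq_cube_def by blast
qed

lemma continuous_char_sum: "continuous_on A (char_sum B c)"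
  unfolding char_sum_def[abs_def] by (intro continuous_intros continuous_character)

lemma char_sum_L2: "char_sum A c \<in> L2_space M"
  by (intro continuous_L2 continuous_char_sum)

lemma L2_integrable: "u \<in> L2_space M \<Longrightarrow> integrable M u"
  using L2_mult_integrable[OF _ character_L2[of 0], of u] by simp

lemma L2_integrable_character: "u \<in> L2_space M \<Longrightarrow> integrable M (\<lambda>x. u x * cnj (character k x))"
  unfolding character_minus[symmetric] by (intro L2_mult_integrable character_L2)

lemma L2_norm_character: "L2_norm M (character k) = sqrt vol"
  by (simp add: L2_norm_def vol_def)

lemma AE_eq_0_of_fourier_coeff_eq_0:
  assumes "u \<in> L2_space M" "\<And>k. fourier_coeff u k = 0"
  shows "AE x in M. u x = 0"
proof (rule AE_eq_0_of_orthogonal[OF L2_integrable[OF assms(1)]])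
  show "(LINT x|M. u x * character k x) = 0" for k
    using assms(2)[of "- k"] vol_pos by (simp add: fourier_coeff_def character_minus)
qed

lemma fourier_coeff_diff:
  assumes "u \<in> L2_space M" "v \<in> L2_space M"
  shows "fourier_coeff (\<lambda>x. u x - v x) k = fourier_coeff u k - fourier_coeff v k"
  using assms[THEN L2_integrable_character[of _ k]]
  by (simp add: fourier_coeff_def left_diff_distrib diff_divide_distrib)

lemma norm_fourier_coeff_le:
  assumes "u \<in> L2_space M"
  shows "cmod (fourier_coeff u k) \<le> L2_norm M u / sqrt vol"
proof -
  have "cmod (LINT x|M. u x * cnj (character k x)) \<le> L2_norm M u * sqrt vol"
    using L2_Cauchy_Schwarz[OF assms character_L2[of "- k"]] by (simp add: character_minus[symmetric] L2_norm_character)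
  then have "cmod (fourier_coeff u k) \<le> L2_norm M u * sqrt vol / vol"
    using vol_pos by (simp add: fourier_coeff_def norm_divide divide_right_mono)
  also have "\<dots> = L2_norm M u / sqrt vol"
    using vol_pos by (simp add: real_div_sqrt field_simps)
  finally show ?thesis .
qed

lemma fourier_coeff_char_sum:
  assumes "finite A"
  shows "fourier_coeff (char_sum A c) k = (if k \<in> A then c k else 0)"
proof -
  have int: "integrable M (\<lambda>x. c l * character (l - k) x)" for l
    by (intro continuous_integrable_M continuous_intros continuous_character)
  have "char_sum A c x * cnj (character k x) = (\<Sum>l\<in>A. c l * character (l - k) x)" for x
    using character_add[of _ "- k" x]
    by (simp add: char_sum_def sum_distrib_right character_minus[symmetric] mult.assoc)
  then have "fourier_coeff (char_sum A c) k = (\<Sum>l\<in>A. c l * (LINT x|M. character (l - k) x)) / of_real vol"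
    using int by (simp add: fourier_coeff_def)
  also have "\<dots> = (\<Sum>l\<in>A. if l = k then c k * of_real vol else 0) / of_real vol"
    by (intro arg_cong2[of _ _ _ _ "(/)"] sum.cong) (auto simp: integral_character)
  also have "\<dots> = (if k \<in> A then c k else 0)"
    using assms vol_pos by simp
  finally show ?thesis .
qed

lemma L2_norm_sq_add:
  assumes "u \<in> L2_space M" "v \<in> L2_space M"
  shows "(L2_norm M (\<lambda>x. u x + v x))\<^sup>2 =
     (L2_norm M u)\<^sup>2 + (L2_norm M v)\<^sup>2 + 2 * Re (LINT x|M. u x * cnj (v x))"
proof -
  have "(\<lambda>x. cnj (v x)) \<in> L2_space M"
    using assms(2) borel_measurable_continuous_on[of cnj v M]
    by (simp add: L2_space_def continuous_on_cnj)
  then have int: "integrable M (\<lambda>x. u x * cnj (v x))"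
    using assms(1) by (intro L2_mult_integrable)
  have "(cmod (p + q))\<^sup>2 = (cmod p)\<^sup>2 + (cmod q)\<^sup>2 + 2 * Re (p * cnj q)" for p q
    unfolding cmod_power2 by (simp add: power2_eq_square algebra_simps)
  then have "(L2_norm M (\<lambda>x. u x + v x))\<^sup>2 =
      (LINT x|M. (cmod (u x))\<^sup>2 + (cmod (v x))\<^sup>2 + 2 * Re (u x * cnj (v x)))"
    by (simp add: L2_norm_sq)
  also have "\<dots> = (L2_norm M u)\<^sup>2 + (L2_norm M v)\<^sup>2 + 2 * (LINT x|M. Re (u x * cnj (v x)))"
    using int[THEN integrable_Re] assms[THEN L2_spaceD(2)] by (simp add: L2_norm_sq del: times_complex.sel)
  also have "(LINT x|M. Re (u x * cnj (v x))) = Re (LINT x|M. u x * cnj (v x))"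
    by (rule integral_Re[OF int])
  finally show ?thesis .
qed

lemma integral_mult_cnj_char_sum:
  assumes "u \<in> L2_space M"
  shows "(LINT x|M. u x * cnj (char_sum A c x)) = of_real vol * (\<Sum>k\<in>A. fourier_coeff u k * cnj (c k))"
proof -
  have "u x * cnj (char_sum A c x) = (\<Sum>k\<in>A. cnj (c k) * (u x * cnj (character k x)))" for x
    by (simp add: char_sum_def sum_distrib_left mult_ac)
  then have "(LINT x|M. u x * cnj (char_sum A c x)) = (\<Sum>k\<in>A. cnj (c k) * (LINT x|M. u x * cnj (character k x)))"
    using L2_integrable_character[OF assms] by simp
  also have "\<dots> = of_real vol * (\<Sum>k\<in>A. fourier_coeff u k * cnj (c k))"
    unfolding sum_distrib_left using vol_pos by (intro sum.cong) (auto simp: fourier_coeff_def)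
  finally show ?thesis .
qed

lemma L2_norm_char_sum:
  assumes "finite A"
  shows "(L2_norm M (char_sum A c))\<^sup>2 = vol * (\<Sum>k\<in>A. (cmod (c k))\<^sup>2)"
proof -
  have "complex_of_real ((L2_norm M (char_sum A c))\<^sup>2) = (LINT x|M. char_sum A c x * cnj (char_sum A c x))"
    by (simp add: L2_norm_sq complex_norm_square[symmetric] flip: of_real_power)
  also have "\<dots> = of_real (vol * (\<Sum>k\<in>A. (cmod (c k))\<^sup>2))"
    by (simp add: integral_mult_cnj_char_sum[OF char_sum_L2] fourier_coeff_char_sum[OF assms] complex_norm_square
      flip: of_real_power cong: sum.cong)
  finally show ?thesis by (simp only: of_real_eq_iff)
qed

lemma L2_norm_remainder:
  assumes u: "u \<in> L2_space M" and A: "finite A"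
  shows "(L2_norm M (\<lambda>x. u x - char_sum A (fourier_coeff u) x))\<^sup>2 =
     (L2_norm M u)\<^sup>2 - vol * (\<Sum>k\<in>A. (cmod (fourier_coeff u k))\<^sup>2)"
proof -
  let ?s = "char_sum A (fourier_coeff u)"
  have w: "(\<lambda>x. u x - ?s x) \<in> L2_space M"
    by (intro L2_space_diff u char_sum_L2)
  have "(LINT x|M. (u x - ?s x) * cnj (?s x)) = 0"
    unfolding integral_mult_cnj_char_sum[OF w] by (simp add: fourier_coeff_diff[OF u char_sum_L2] fourier_coeff_char_sum[OF A])
  then show ?thesis
    using L2_norm_sq_add[OF w char_sum_L2[of A "fourier_coeff u"]] L2_norm_char_sum[OF A, of "fourier_coeff u"] by simp
qed

lemma char_sum_diff:
  assumes "finite B" "A \<subseteq> B"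
  shows "char_sum B c x - char_sum A c x = char_sum (B - A) c x"
  using sum.subset_diff[OF assms(2,1), of "\<lambda>k. c k * character k x"] by (simp add: char_sum_def)

text \<open>
  Bessel's inequality makes the Fourier series a Cauchy series; by completeness it converges in
  \<open>L\<^sup>2\<close>, and its sum has the same coefficients as \<open>u\<close>, hence equals \<open>u\<close> by uniqueness.
\<close>

theorem Fourier_series_tendsto:
  assumes u: "u \<in> L2_space M"
  shows "(\<lambda>N. L2_norm M (\<lambda>x. u x - char_sum (freq_cube N) (fourier_coeff u) x)) \<longlonglongrightarrow> 0"
    and "(\<lambda>N. vol * (\<Sum>k\<in>freq_cube N. (cmod (fourier_coeff u k))\<^sup>2)) \<longlonglongrightarrow> (L2_norm M u)\<^sup>2"
proof -
  let ?P = "\<lambda>N. char_sum (freq_cube N) (fourier_coeff u)"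
  define s where "s N = vol * (\<Sum>k\<in>freq_cube N. (cmod (fourier_coeff u k))\<^sup>2)" for N
  have rem: "(L2_norm M (\<lambda>x. u x - ?P N x))\<^sup>2 = (L2_norm M u)\<^sup>2 - s N" for N
    unfolding s_def by (intro L2_norm_remainder u finite_freq_cube)
  have "incseq s"
    unfolding s_def using vol_pos
    by (intro incseq_SucI mult_left_mono sum_mono2 freq_cube_mono) auto
  moreover have s_le: "s N \<le> (L2_norm M u)\<^sup>2" for N
    using rem[of N] zero_le_power2[of "L2_norm M (\<lambda>x. u x - ?P N x)"] by linarith
  ultimately obtain L where L: "s \<longlonglongrightarrow> L"
    using incseq_convergent[of s] by blast
  have incr: "(L2_norm M (\<lambda>x. ?P m x - ?P n x))\<^sup>2 = s m - s n" if "n \<le> m" for m n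
  proof -
    have "(L2_norm M (\<lambda>x. ?P m x - ?P n x))\<^sup>2 = vol * (\<Sum>k\<in>freq_cube m - freq_cube n. (cmod (fourier_coeff u k))\<^sup>2)"
      by (simp add: char_sum_diff freq_cube_mono that L2_norm_char_sum)
    also have "\<dots> = s m - s n"
      using sum.subset_diff[OF freq_cube_mono[OF that] finite_freq_cube, of "\<lambda>k. (cmod (fourier_coeff u k))\<^sup>2"]
      by (simp add: s_def algebra_simps)
    finally show ?thesis .
  qed
  have "\<exists>N. \<forall>m\<ge>N. \<forall>n\<ge>N. \<bar>s m - s n\<bar> < (1/4) ^ j" for j :: nat
    using metric_CauchyD[OF LIMSEQ_imp_Cauchy[OF L], of "(1/4) ^ j"] by (simp add: dist_real_def)
  then obtain T where T: "\<And>j m n. T j \<le> m \<Longrightarrow> T j \<le> n \<Longrightarrow> \<bar>s m - s n\<bar> < (1/4) ^ j"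
    by metis
  \<comment> \<open>indices beyond every threshold needed so far, increasing and unbounded\<close>
  define r where "r j = j + (\<Sum>i\<le>j. T i)" for j
  have rT: "T j \<le> r j" and rj: "j \<le> r j" and rS: "r j \<le> r (Suc j)" for j
    using member_le_sum[of j "{..j}" T] by (auto simp: r_def)
  define v where "v j x = ?P (r (Suc j)) x - ?P (r j) x" for j x
  have vL: "v j \<in> L2_space M" for j
    unfolding v_def[abs_def] by (intro L2_space_diff char_sum_L2)
  have vn: "L2_norm M (v j) \<le> (1/2) ^ j" for j
  proof (rule power2_le_imp_le)
    have "(L2_norm M (v j))\<^sup>2 = s (r (Suc j)) - s (r j)"
      unfolding v_def[abs_def] by (rule incr[OF rS])
    also have "\<dots> \<le> (1/4) ^ j"
      using T[of j "r (Suc j)" "r j"] rT[of j] rS[of j] by simp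
    also have "\<dots> = ((1/2) ^ j)\<^sup>2"
      by (simp add: power2_eq_square power_mult_distrib[symmetric])
    finally show "(L2_norm M (v j))\<^sup>2 \<le> ((1/2) ^ j)\<^sup>2" .
  qed simp
  have vs: "summable (\<lambda>j. L2_norm M (v j))"
    by (rule summable_comparison_test'[of "\<lambda>j. (1/2 :: real) ^ j"]) (use vn in auto)
  obtain w where w: "w \<in> L2_space M"
    and tail: "\<And>N. L2_norm M (\<lambda>x. w x - (\<Sum>j<N. v j x)) \<le> (\<Sum>j. L2_norm M (v (j + N)))"
    using L2_series_converges[OF finite_M vL vs] by blast
  define h where "h x = w x + ?P (r 0) x" for x
  have h: "h \<in> L2_space M"
    unfolding h_def[abs_def] by (intro L2_space_add w char_sum_L2)
  have tail0: "(\<lambda>N. \<Sum>j. L2_norm M (v (j + N))) \<longlonglongrightarrow> 0"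
  proof -
    have "(\<lambda>N. (\<Sum>j. L2_norm M (v j)) - (\<Sum>j<N. L2_norm M (v j))) \<longlonglongrightarrow> (\<Sum>j. L2_norm M (v j)) - (\<Sum>j. L2_norm M (v j))"
      by (intro tendsto_intros summable_LIMSEQ vs)
    then show ?thesis
      by (simp add: suminf_minus_initial_segment[OF vs])
  qed
  have hP: "(\<lambda>N. L2_norm M (\<lambda>x. h x - ?P (r N) x)) \<longlonglongrightarrow> 0"
  proof (rule tendsto_sandwich[OF _ _ tendsto_const tail0])
    have "(\<Sum>j<N. v j x) = ?P (r N) x - ?P (r 0) x" for N x
      unfolding v_def by (rule sum_lessThan_telescope)
    then have "w x - (\<Sum>j<N. v j x) = h x - ?P (r N) x" for N x
      by (simp only: h_def) simp
    then have "L2_norm M (\<lambda>x. h x - ?P (r N) x) = L2_norm M (\<lambda>x. w x - (\<Sum>j<N. v j x))" for N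
      by (simp only:)
    then show "\<forall>\<^sub>F N in sequentially. L2_norm M (\<lambda>x. h x - ?P (r N) x) \<le> (\<Sum>j. L2_norm M (v (j + N)))"
      using tail by simp
  qed auto
  have "fourier_coeff h k = fourier_coeff u k" for k
  proof -
    obtain N where N: "k \<in> freq_cube N" using ex_freq_cube by blast
    have "(\<lambda>j. L2_norm M (\<lambda>x. h x - ?P (r j) x) / sqrt vol) \<longlonglongrightarrow> 0 / sqrt vol"
      using vol_pos by (intro tendsto_divide hP tendsto_const) auto
    moreover have "\<forall>\<^sub>F j in sequentially. cmod (fourier_coeff h k - fourier_coeff u k) \<le> L2_norm M (\<lambda>x. h x - ?P (r j) x) / sqrt vol"
    proof (rule eventually_sequentiallyI[of N])
      fix j assume "N \<le> j"
      then have "k \<in> freq_cube (r j)"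
        using N freq_cube_mono[of N "r j"] rj[of j] by auto
      then show "cmod (fourier_coeff h k - fourier_coeff u k) \<le> L2_norm M (\<lambda>x. h x - ?P (r j) x) / sqrt vol"
        using norm_fourier_coeff_le[OF L2_space_diff[OF h char_sum_L2], of "freq_cube (r j)" "fourier_coeff u" k]
        by (simp add: fourier_coeff_diff[OF h char_sum_L2] fourier_coeff_char_sum)
    qed
    ultimately have "cmod (fourier_coeff h k - fourier_coeff u k) \<le> 0 / sqrt vol"
      by (rule tendsto_lowerbound) simp
    then show ?thesis by simp
  qed
  then have "AE x in M. h x - u x = 0"
    by (intro AE_eq_0_of_fourier_coeff_eq_0 L2_space_diff h u) (simp add: fourier_coeff_diff[OF h u])
  then have "L2_norm M (\<lambda>x. u x - ?P (r N) x) = L2_norm M (\<lambda>x. h x - ?P (r N) x)" for N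
    by (intro L2_norm_cong_AE L2_spaceD(1)[OF L2_space_diff] u h char_sum_L2) auto
  then have "(\<lambda>N. (L2_norm M (\<lambda>x. u x - ?P (r N) x))\<^sup>2) \<longlonglongrightarrow> 0\<^sup>2"
    using hP by (intro tendsto_power) simp
  then have "(\<lambda>N. (L2_norm M u)\<^sup>2 - s (r N)) \<longlonglongrightarrow> 0"
    by (simp add: rem)
  moreover have "(\<lambda>N. (L2_norm M u)\<^sup>2 - s (r N)) \<longlonglongrightarrow> (L2_norm M u)\<^sup>2 - L"
  proof -
    have "filterlim r sequentially sequentially"
      by (rule filterlim_at_top_mono[OF filterlim_ident]) (auto simp: rj)
    then show ?thesis
      by (intro tendsto_diff tendsto_const filterlim_compose[OF L])
  qed
  ultimately have L_eq: "L = (L2_norm M u)\<^sup>2"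
    using LIMSEQ_unique by fastforce
  then show "(\<lambda>N. vol * (\<Sum>k\<in>freq_cube N. (cmod (fourier_coeff u k))\<^sup>2)) \<longlonglongrightarrow> (L2_norm M u)\<^sup>2"
    using L by (simp add: s_def[abs_def])
  have "(\<lambda>N. (L2_norm M u)\<^sup>2 - s N) \<longlonglongrightarrow> (L2_norm M u)\<^sup>2 - L"
    by (intro tendsto_intros L)
  then have "(\<lambda>N. (L2_norm M (\<lambda>x. u x - ?P N x))\<^sup>2) \<longlonglongrightarrow> 0"
    by (simp add: rem L_eq)
  then have "(\<lambda>N. sqrt ((L2_norm M (\<lambda>x. u x - ?P N x))\<^sup>2)) \<longlonglongrightarrow> sqrt 0"
    by (rule tendsto_real_sqrt)
  then show "(\<lambda>N. L2_norm M (\<lambda>x. u x - ?P N x)) \<longlonglongrightarrow> 0"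
    by simp
qed

end

section \<open>The heat semigroup on Fourier modes\<close>

lemma exp_difference_quotient:
  fixes c :: real
  shows "((\<lambda>h. (exp (c * h) - 1) / h) \<longlongrightarrow> c) (at_right 0)"
proof -
  have "((\<lambda>h. exp (c * h)) has_field_derivative c) (at 0)"
    by (auto intro!: derivative_eq_intros)
  then have "((\<lambda>h. (exp (c * h) - 1) / h) \<longlongrightarrow> c) (at 0)"
    by (simp add: has_field_derivative_iff)
  then show ?thesis
    by (rule tendsto_mono[rotated]) (simp add: at_le)
qed

text \<open>
  An eigenvector of the generator with eigenvalue \<open>-\<lambda>\<close> satisfies \<open>\<parallel>S\<^sub>h u - e\<^sup>-\<^sup>\<lambda>\<^sup>h u\<parallel> = o(h)\<close>.  Splitting
  \<open>[0, t]\<close> into \<open>n\<close> steps and telescoping, the error at time \<open>t\<close> is at most \<open>n C o(t/n)\<close>, which tends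
  to zero.  The uniform bound \<open>C\<close> is what keeps the propagated errors under control.
\<close>

lemma C0_semigroup_eigenvector:
  assumes S: "C0_semigroup M S"
    and bound: "\<And>t u. 0 \<le> t \<Longrightarrow> t \<le> \<delta> \<Longrightarrow> u \<in> L2_space M \<Longrightarrow> L2_norm M (S t u) \<le> C * L2_norm M u"
    and gen: "generator_graph M S u (\<lambda>x. - of_real l * u x)" and l: "0 \<le> l"
    and t: "0 \<le> t" "t \<le> \<delta>"
  shows "AE x in M. S t u x = of_real (exp (- l * t)) * u x"
proof -
  have u: "u \<in> L2_space M" using gen by (simp add: generator_graph_def)
  have SL: "S s v \<in> L2_space M" if "0 \<le> s" "v \<in> L2_space M" for s v
    using S that by (simp add: C0_semigroup_def)
  have S0: "AE x in M. S 0 u x = u x"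
    using S u by (simp add: C0_semigroup_def)
  define q where "q h = L2_norm M (\<lambda>x. S h u x - of_real (exp (- l * h)) * u x)" for h
  have q0: "0 \<le> q h" for h by (simp add: q_def)
  have telescope: "L2_norm M (\<lambda>x. S (real m * h) u x - of_real (exp (- l * (real m * h))) * u x) \<le> real m * (C * q h)"
    if h: "0 \<le> h" and "real m * h \<le> \<delta>" for h m
    using that(2)
  proof (induction m)
    case 0
    have "L2_norm M (\<lambda>x. S 0 u x - u x) = L2_norm M (\<lambda>x. 0)"
      by (intro L2_norm_cong_AE L2_spaceD(1)[OF L2_space_diff] SL u) (use S0 in auto)
    then show ?case by (simp add: L2_norm_def)
  next
    case (Suc m)
    let ?s = "real m * h" and ?r = "complex_of_real (exp (- l * h))"
    have s: "0 \<le> ?s" "?s \<le> \<delta>"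
      using h Suc.prems mult_right_mono[of "real m" "real (Suc m)" h] by auto
    let ?d = "\<lambda>x. S h u x + (- ?r) * u x"
    let ?e = "\<lambda>x. S ?s u x - of_real (exp (- l * ?s)) * u x"
    have dL: "?d \<in> L2_space M" and eL: "?e \<in> L2_space M"
      by (intro L2_space_add L2_space_diff L2_space_cmult SL h u s)+
    have "AE x in M. S (?s + h) u x = S ?s (S h u) x"
      using S u s h by (simp add: C0_semigroup_def)
    moreover have "AE x in M. S ?s ?d x = S ?s (S h u) x + (- ?r) * S ?s u x"
      using S u s SL[OF h u] unfolding C0_semigroup_def by blast
    moreover have "complex_of_real (exp (- l * (?s + h))) = ?r * of_real (exp (- l * ?s))"
      by (simp add: exp_add[symmetric] algebra_simps flip: of_real_mult)
    ultimately have "AE x in M. S (?s + h) u x - of_real (exp (- l * (?s + h))) * u x = S ?s ?d x + ?r * ?e x"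
      by (auto simp: algebra_simps)
    then have "L2_norm M (\<lambda>x. S (?s + h) u x - of_real (exp (- l * (?s + h))) * u x) = L2_norm M (\<lambda>x. S ?s ?d x + ?r * ?e x)"
      by (intro L2_norm_cong_AE L2_spaceD(1)[OF L2_space_diff] L2_spaceD(1)[OF L2_space_add] L2_space_cmult SL dL eL u)
        (use s h in auto)
    also have "\<dots> \<le> L2_norm M (S ?s ?d) + L2_norm M (\<lambda>x. ?r * ?e x)"
      by (intro L2_norm_triangle L2_space_cmult SL s dL eL)
    also have "\<dots> \<le> C * q h + real m * (C * q h)"
    proof (rule add_mono)
      show "L2_norm M (S ?s ?d) \<le> C * q h"
        using bound[OF s dL] by (simp add: q_def)
      have "exp (- l * h) \<le> 1" using l h by simp
      then have "L2_norm M (\<lambda>x. ?r * ?e x) \<le> 1 * L2_norm M ?e"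
        unfolding L2_norm_cmult norm_of_real by (intro mult_right_mono) auto
      then show "L2_norm M (\<lambda>x. ?r * ?e x) \<le> real m * (C * q h)"
        using Suc.IH[OF s(2)] by simp
    qed
    finally show ?case by (simp add: algebra_simps)
  qed
  have q_small: "((\<lambda>h. q h / h) \<longlongrightarrow> 0) (at_right 0)"
  proof -
    let ?p = "\<lambda>h. L2_norm M (\<lambda>x. (S h u x - u x) / of_real h - - of_real l * u x)"
    let ?g = "\<lambda>h. ?p h + \<bar>(exp (- l * h) - 1) / h - - l\<bar> * L2_norm M u"
    have p0: "(?p \<longlongrightarrow> 0) (at_right 0)"
      using gen by (simp add: generator_graph_def)
    have e0: "((\<lambda>h. \<bar>(exp (- l * h) - 1) / h - - l\<bar>) \<longlongrightarrow> \<bar>- l - - l\<bar>) (at_right 0)"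
      by (intro tendsto_rabs tendsto_diff tendsto_const exp_difference_quotient)
    have g0: "(?g \<longlongrightarrow> 0 + \<bar>- l - - l\<bar> * L2_norm M u) (at_right 0)"
      by (intro tendsto_add tendsto_mult tendsto_const p0 e0)
    have le: "q h / h \<le> ?g h" if h: "0 < h" for h
    proof -
      let ?a = "\<lambda>x. (S h u x - u x) / of_real h - - of_real l * u x"
      let ?c = "complex_of_real ((exp (- l * h) - 1) / h - - l)"
      have aL: "?a \<in> L2_space M"
        using h L2_space_diff[OF L2_space_cmult[OF L2_space_diff[OF SL[of h, OF _ u] u], of "1 / of_real h"] L2_space_cmult[OF u, of "- of_real l"]]
        by simp
      have "q h / h = L2_norm M (\<lambda>x. of_real (1 / h) * (S h u x - of_real (exp (- l * h)) * u x))"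
        unfolding L2_norm_cmult norm_of_real q_def using h by simp
      also have "\<dots> = L2_norm M (\<lambda>x. ?a x + (- ?c) * u x)"
        using h by (intro arg_cong[of _ _ "L2_norm M"] ext) (simp add: field_simps)
      also have "\<dots> \<le> L2_norm M ?a + L2_norm M (\<lambda>x. (- ?c) * u x)"
        by (intro L2_norm_triangle aL L2_space_cmult u)
      also have "\<dots> = ?g h"
        unfolding L2_norm_cmult norm_minus_cancel norm_of_real ..
      finally show ?thesis .
    qed
    show ?thesis
    proof (rule tendsto_sandwich[OF _ _ tendsto_const])
      show "(?g \<longlongrightarrow> 0) (at_right 0)" using g0 by simp
      show "\<forall>\<^sub>F h in at_right 0. q h / h \<le> ?g h"
        by (rule eventually_mono[OF eventually_at_right_less[of 0]]) (rule le)
      show "\<forall>\<^sub>F h in at_right 0. 0 \<le> q h / h"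
        by (rule eventually_mono[OF eventually_at_right_less[of 0]]) (use q0 in auto)
    qed
  qed
  let ?w = "\<lambda>x. S t u x - of_real (exp (- l * t)) * u x"
  have wL: "?w \<in> L2_space M"
    by (intro L2_space_diff L2_space_cmult SL t u)
  have "L2_norm M ?w = 0"
  proof (cases "t = 0")
    case True
    then show ?thesis
      using telescope[of 0 0] t L2_norm_nonneg[of M ?w] by (intro antisym) simp_all
  next
    case False
    then have tp: "0 < t" using t by simp
    have "(\<lambda>n. t / real (Suc n)) \<longlonglongrightarrow> 0"
      using tendsto_mult_right[OF LIMSEQ_inverse_real_of_nat, of t] by (simp add: divide_inverse mult.commute)
    then have filt: "filterlim (\<lambda>n. t / real (Suc n)) (at_right 0) sequentially"
      unfolding filterlim_at using tp by (simp add: less_imp_neq[symmetric] del: of_nat_Suc)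
    have "(\<lambda>n. q (t / real (Suc n)) / (t / real (Suc n)) * (C * t)) \<longlonglongrightarrow> 0 * (C * t)"
      by (intro tendsto_mult tendsto_const filterlim_compose[OF q_small filt])
    moreover have "L2_norm M ?w \<le> q (t / real (Suc n)) / (t / real (Suc n)) * (C * t)" for n
      using telescope[of "t / real (Suc n)" "Suc n"] t tp by (simp add: field_simps del: of_nat_Suc)
    ultimately have "L2_norm M ?w \<le> 0 * (C * t)"
      by (intro LIMSEQ_le_const) auto
    then show ?thesis
      by (intro antisym L2_norm_nonneg) simp
  qed
  from L2_norm_eq_0D[OF wL this] show ?thesis by simp
qed

context periodic_box
begin

definition eigenvalue :: "int ^ 'n \<Rightarrow> real" where
  "eigenvalue k = (\<Sum>i\<in>UNIV. (freq k i)\<^sup>2)"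

lemma eigenvalue_nonneg [simp]: "0 \<le> eigenvalue k"
  by (simp add: eigenvalue_def sum_nonneg)

lemma weak_partialD:
  assumes "weak_partial a b i u g"
  shows "u \<in> L2_space M" "g \<in> L2_space M"
    "\<And>\<psi>. \<psi> \<in> periodic_test a b \<Longrightarrow> (LINT x|M. u x * partial_deriv i \<psi> x) = - (LINT x|M. g x * \<psi> x)"
  using assms by (auto simp: weak_partial_def)

lemma fourier_coeff_weak_partial:
  assumes "weak_partial a b i u g"
  shows "fourier_coeff g k = \<i> * of_real (freq k i) * fourier_coeff u k"
proof -
  have "(LINT x|M. u x * partial_deriv i (character (- k)) x) = - (LINT x|M. g x * character (- k) x)"
    by (rule weak_partialD(3)[OF assms character_periodic_test])
  moreover have "partial_deriv i (character (- k)) x = - (\<i> * of_real (freq k i)) * character (- k) x" for x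
    using fun_cong[OF partial_deriv_character[of i 1 "- k"], of x] by (simp add: freq_def)
  ultimately have "(LINT x|M. - (\<i> * of_real (freq k i)) * (u x * character (- k) x)) = - (LINT x|M. g x * character (- k) x)"
    by (simp add: mult_ac)
  then have "\<i> * of_real (freq k i) * (LINT x|M. u x * character (- k) x) = (LINT x|M. g x * character (- k) x)"
    by simp
  then show ?thesis
    by (simp add: fourier_coeff_def character_minus[symmetric])
qed

text \<open>Characters are admissible test functions, and they already determine the weak derivative.\<close>

lemma weak_partial_unique:
  assumes "weak_partial a b i u g" "weak_partial a b i u g'"
  shows "AE x in M. g x = g' x"
proof -
  have "AE x in M. g x - g' x = 0"
    using assms[THEN weak_partialD(2)]
    by (intro AE_eq_0_of_fourier_coeff_eq_0 L2_space_diff)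
      (simp_all add: fourier_coeff_diff assms[THEN fourier_coeff_weak_partial])
  then show ?thesis by simp
qed

lemma weak_partial_cong_AE:
  assumes u: "weak_partial a b i u g" and v: "v \<in> L2_space M" and eq: "AE x in M. v x = u x"
  shows "weak_partial a b i v g"
  unfolding weak_partial_def
proof (intro conjI ballI v weak_partialD(2)[OF u])
  fix \<psi> assume \<psi>: "\<psi> \<in> periodic_test a b"
  then have "C_k (Suc 0) \<psi>" by (auto simp: periodic_test_def)
  then have m: "partial_deriv i \<psi> \<in> borel_measurable M"
    using borel_measurable_integrable[OF continuous_integrable_M] by auto
  have "(LINT x|M. v x * partial_deriv i \<psi> x) = (LINT x|M. u x * partial_deriv i \<psi> x)"
    using m v weak_partialD(1)[OF u] eq by (intro integral_cong_AE) (auto dest!: L2_spaceD(1))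
  then show "(LINT x|M. v x * partial_deriv i \<psi> x) = - (LINT x|M. g x * \<psi> x)"
    using weak_partialD(3)[OF u \<psi>] by simp
qed

lemma weak_partial_weak_deriv: "weak_partial a b i u g \<Longrightarrow> weak_partial a b i u (weak_deriv a b i u)"
  unfolding weak_deriv_def by (rule someI[of "weak_partial a b i u"])

lemma weak_deriv_eq_AE: "weak_partial a b i u g \<Longrightarrow> AE x in M. weak_deriv a b i u x = g x"
  using weak_partial_unique weak_partial_weak_deriv by blast

lemma weak_partial_weak_deriv_character:
  "weak_partial a b j (weak_deriv a b i (character k)) (\<lambda>x. - of_real (freq k i * freq k j) * character k x)"
proof (rule weak_partial_cong_AE)
  note 1 = weak_partial_character[of i 1 k, simplified]
  show "weak_partial a b j (\<lambda>x. \<i> * of_real (freq k i) * character k x) (\<lambda>x. - of_real (freq k i * freq k j) * character k x)"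
  proof -
    have "\<i> * complex_of_real (freq k i) * (\<i> * complex_of_real (freq k j)) = - of_real (freq k i * freq k j)"
      by (simp add: complex_eq_iff)
    then show ?thesis
      using weak_partial_character[of j "\<i> * of_real (freq k i)" k] by simp
  qed
  show "weak_deriv a b i (character k) \<in> L2_space M"
    using weak_partialD(2)[OF weak_partial_weak_deriv[OF 1]] .
  show "AE x in M. weak_deriv a b i (character k) x = \<i> * of_real (freq k i) * character k x"
    by (rule weak_deriv_eq_AE[OF 1])
qed

lemma character_H2: "character k \<in> H2_per a b"
proof -
  have "weak_deriv a b i (character k) \<in> H1_per a b" for i
    using weak_partial_weak_deriv_character weak_partialD(1) unfolding H1_per_def by blast
  moreover have "character k \<in> H1_per a b"
    using weak_partial_character[of _ 1 k, simplified] character_L2 unfolding H1_per_def by blast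
  ultimately show ?thesis by (simp add: H2_per_def)
qed

lemma weak_laplacian_character:
  "AE x in M. weak_laplacian a b (character k) x = - of_real (eigenvalue k) * character k x"
proof -
  have "AE x in M. \<forall>i\<in>UNIV. weak_deriv a b i (weak_deriv a b i (character k)) x = - of_real (freq k i * freq k i) * character k x"
    by (rule AE_finite_allI[OF finite]) (rule weak_deriv_eq_AE[OF weak_partial_weak_deriv_character])
  then show ?thesis
  proof eventually_elim
    case (elim x)
    then have "weak_laplacian a b (character k) x = (\<Sum>i\<in>UNIV. - of_real (freq k i * freq k i) * character k x)"
      by (simp add: weak_laplacian_def)
    then show ?case
      by (simp add: eigenvalue_def power2_eq_square sum_distrib_right sum_negf)
  qed
qed

text \<open>
  Parseval's identity for each weak derivative, whose coefficients are those of \<open>u\<close> times \<open>\<i>\<close> times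
  the frequency.
\<close>

lemma H1_gradient_norm_tendsto:
  assumes "u \<in> H1_per a b"
  shows "(\<lambda>N. vol * (\<Sum>k\<in>freq_cube N. eigenvalue k * (cmod (fourier_coeff u k))\<^sup>2))
     \<longlonglongrightarrow> (\<Sum>i\<in>UNIV. (L2_norm M (weak_deriv a b i u))\<^sup>2)"
proof -
  have wp: "weak_partial a b i u (weak_deriv a b i u)" for i
    using assms weak_partial_weak_deriv unfolding H1_per_def by blast
  have "(\<lambda>N. vol * (\<Sum>k\<in>freq_cube N. (cmod (fourier_coeff (weak_deriv a b i u) k))\<^sup>2))
      \<longlonglongrightarrow> (L2_norm M (weak_deriv a b i u))\<^sup>2" for i
    by (rule Fourier_series_tendsto(2)[OF weak_partialD(2)[OF wp]])
  then have "(\<lambda>N. \<Sum>i\<in>UNIV. vol * (\<Sum>k\<in>freq_cube N. (cmod (fourier_coeff (weak_deriv a b i u) k))\<^sup>2))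
      \<longlonglongrightarrow> (\<Sum>i\<in>UNIV. (L2_norm M (weak_deriv a b i u))\<^sup>2)"
    by (intro tendsto_sum)
  moreover have "(\<Sum>i\<in>UNIV. vol * (\<Sum>k\<in>A. (cmod (fourier_coeff (weak_deriv a b i u) k))\<^sup>2)) =
      vol * (\<Sum>k\<in>A. eigenvalue k * (cmod (fourier_coeff u k))\<^sup>2)" for A
    unfolding sum_distrib_left[symmetric]
    by (subst sum.swap)
      (simp add: fourier_coeff_weak_partial[OF wp] norm_mult power_mult_distrib eigenvalue_def sum_distrib_right)
  ultimately show ?thesis by simp
qed

context
  fixes S :: "real \<Rightarrow> (real ^ 'n \<Rightarrow> complex) \<Rightarrow> real ^ 'n \<Rightarrow> complex"
  assumes heat: "heat_semigroup a b S"
begin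

lemma S_C0: "C0_semigroup M S"
  using heat by (simp add: heat_semigroup_def)

lemma generator_character: "generator_graph M S (character k) (\<lambda>x. - of_real (eigenvalue k) * character k x)"
proof -
  have "AE x in M. - of_real (eigenvalue k) * character k x = weak_laplacian a b (character k) x"
    using weak_laplacian_character[of k] by eventually_elim simp
  then show ?thesis
    using heat character_H2[of k] L2_space_cmult[OF character_L2[of k]] unfolding heat_semigroup_def by blast
qed

text \<open>
  Each operator is known on the characters, hence on partial sums of the Fourier series, and it is
  continuous; so it multiplies the \<open>k\<close>-th coefficient by \<open>e\<^sup>-\<^sup>\<lambda>\<^sup>t\<close>, where \<open>\<lambda>\<close> is the \<open>k\<close>-th eigenvalue.
\<close>

lemma heat_norm_tendsto:
  "\<exists>\<delta>>0. \<forall>t u. 0 \<le> t \<longrightarrow> t \<le> \<delta> \<longrightarrow> u \<in> L2_space M \<longrightarrow>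
      (\<lambda>N. vol * (\<Sum>k\<in>freq_cube N. exp (- 2 * eigenvalue k * t) * (cmod (fourier_coeff u k))\<^sup>2))
        \<longlonglongrightarrow> (L2_norm M (S t u))\<^sup>2"
proof -
  obtain \<delta> C where "\<delta> > 0" and bound: "\<And>t u. 0 \<le> t \<Longrightarrow> t \<le> \<delta> \<Longrightarrow> u \<in> L2_space M \<Longrightarrow> L2_norm M (S t u) \<le> C * L2_norm M u"
    using C0_semigroup_locally_bounded[OF finite_M S_C0] by metis
  have "(\<lambda>N. vol * (\<Sum>k\<in>freq_cube N. exp (- 2 * eigenvalue k * t) * (cmod (fourier_coeff u k))\<^sup>2))
        \<longlonglongrightarrow> (L2_norm M (S t u))\<^sup>2" if t: "0 \<le> t" "t \<le> \<delta>" and u: "u \<in> L2_space M" for t u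
  proof -
    have SL: "S t v \<in> L2_space M" if "v \<in> L2_space M" for v
      using S_C0 t that by (simp add: C0_semigroup_def)
    have lin: "AE x in M. S t (\<lambda>y. v y + c * w y) x = S t v x + c * S t w x"
      if "v \<in> L2_space M" "w \<in> L2_space M" for v w c
      using S_C0 t that unfolding C0_semigroup_def by blast
    have mode: "AE x in M. S t (character k) x = of_real (exp (- eigenvalue k * t)) * character k x" for k
      by (rule C0_semigroup_eigenvector[OF S_C0 bound generator_character eigenvalue_nonneg t])
    have zero: "AE x in M. S t (\<lambda>x. 0) x = 0"
    proof (rule L2_norm_eq_0D[OF SL[OF L2_space_zero]])
      show "L2_norm M (S t (\<lambda>x. 0)) = 0"
        using bound[OF t L2_space_zero] L2_norm_nonneg[of M "S t (\<lambda>x. 0)"]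
        by (simp add: L2_norm_def[of M "\<lambda>x. 0"])
    qed
    have fin: "AE x in M. S t (char_sum A c) x = char_sum A (\<lambda>k. of_real (exp (- eigenvalue k * t)) * c k) x"
      if "finite A" for A c
      using that
    proof (induction A)
      case empty
      then show ?case using zero by (simp add: char_sum_def[abs_def])
    next
      case (insert k A)
      have ins: "char_sum (insert k A) d x = char_sum A d x + d k * character k x" for d x
        using insert.hyps by (simp add: char_sum_def)
      then have "char_sum (insert k A) c = (\<lambda>x. char_sum A c x + c k * character k x)"
        by (simp add: fun_eq_iff)
      then have "AE x in M. S t (char_sum (insert k A) c) x = S t (char_sum A c) x + c k * S t (character k) x"
        using lin[OF char_sum_L2 character_L2] by simp
      then show ?case
        using insert.IH mode[of k]
      proof eventually_elim
        case (elim x)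
        then show ?case
          unfolding ins[of "\<lambda>k. of_real (exp (- eigenvalue k * t)) * c k"] by simp
      qed
    qed
    let ?P = "\<lambda>N. char_sum (freq_cube N) (fourier_coeff u)"
    have "(\<lambda>N. L2_norm M (\<lambda>x. S t (?P N) x - S t u x)) \<longlonglongrightarrow> 0"
    proof (rule tendsto_sandwich[OF _ _ tendsto_const])
      have "(\<lambda>N. C * L2_norm M (\<lambda>x. u x - ?P N x)) \<longlonglongrightarrow> C * 0"
        by (intro tendsto_mult tendsto_const Fourier_series_tendsto(1) u)
      then show "(\<lambda>N. C * L2_norm M (\<lambda>x. u x - ?P N x)) \<longlonglongrightarrow> 0" by simp
      have "L2_norm M (\<lambda>x. S t (?P N) x - S t u x) \<le> C * L2_norm M (\<lambda>x. u x - ?P N x)" for N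
      proof -
        have "AE x in M. S t (\<lambda>y. ?P N y + (-1) * u y) x = S t (?P N) x + (-1) * S t u x"
          by (rule lin[OF char_sum_L2 u])
        then have "L2_norm M (\<lambda>x. S t (?P N) x - S t u x) = L2_norm M (S t (\<lambda>y. ?P N y + (-1) * u y))"
          by (intro L2_norm_cong_AE L2_spaceD(1)[OF L2_space_diff] L2_spaceD(1)[OF SL] SL char_sum_L2 u L2_space_add L2_space_cmult) auto
        also have "\<dots> \<le> C * L2_norm M (\<lambda>y. ?P N y + (-1) * u y)"
          by (intro bound t L2_space_add L2_space_cmult char_sum_L2 u)
        finally show ?thesis by (simp add: L2_norm_minus_commute[of M u])
      qed
      then show "\<forall>\<^sub>F N in sequentially. L2_norm M (\<lambda>x. S t (?P N) x - S t u x) \<le> C * L2_norm M (\<lambda>x. u x - ?P N x)"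
        by simp
    qed simp
    then have "(\<lambda>N. L2_norm M (S t (?P N))) \<longlonglongrightarrow> L2_norm M (S t u)"
      by (rule L2_norm_tendsto[OF SL[OF char_sum_L2] SL[OF u]])
    then have "(\<lambda>N. (L2_norm M (S t (?P N)))\<^sup>2) \<longlonglongrightarrow> (L2_norm M (S t u))\<^sup>2"
      by (rule tendsto_power)
    moreover have "(L2_norm M (S t (?P N)))\<^sup>2 = vol * (\<Sum>k\<in>freq_cube N. exp (- 2 * eigenvalue k * t) * (cmod (fourier_coeff u k))\<^sup>2)" for N
    proof -
      have "L2_norm M (S t (?P N)) = L2_norm M (char_sum (freq_cube N) (\<lambda>k. of_real (exp (- eigenvalue k * t)) * fourier_coeff u k))"
        by (intro L2_norm_cong_AE L2_spaceD(1)[OF SL] L2_spaceD(1)[OF char_sum_L2] char_sum_L2 fin) simp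
      moreover have "(exp (- eigenvalue k * t))\<^sup>2 = exp (- 2 * eigenvalue k * t)" for k
        by (simp add: power2_eq_square exp_add[symmetric])
      ultimately show ?thesis
        by (simp add: L2_norm_char_sum norm_mult power_mult_distrib)
    qed
    ultimately show ?thesis by simp
  qed
  with \<open>\<delta> > 0\<close> show ?thesis by blast
qed

text \<open>
  With \<open>c\<^sub>k\<close> the Fourier coefficients and \<open>\<lambda>\<^sub>k\<close> the eigenvalues, the difference quotient is
  \<open>\<Sum> \<bar>c\<^sub>k\<bar>\<^sup>2 (1 - e\<^sup>-\<^sup>2\<^sup>\<lambda>\<^sup>t) / 2t\<close> up to the volume factor.  Each term is at most its limit \<open>\<lambda>\<^sub>k \<bar>c\<^sub>k\<bar>\<^sup>2\<close>,
  which bounds the quotient above by the Dirichlet energy; finitely many terms bound it below.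
\<close>

theorem heat_energy_dissipation:
  assumes u: "u \<in> H1_per a b"
  shows "((\<lambda>t. ((L2_norm M u)\<^sup>2 - (L2_norm M (S t u))\<^sup>2) / (2 * t))
     \<longlongrightarrow> (\<Sum>i\<in>UNIV. (L2_norm M (weak_deriv a b i u))\<^sup>2)) (at_right 0)"
proof -
  have uL: "u \<in> L2_space M" using u by (simp add: H1_per_def)
  define G where "G = (\<Sum>i\<in>UNIV. (L2_norm M (weak_deriv a b i u))\<^sup>2)"
  define p where "p k = (cmod (fourier_coeff u k))\<^sup>2" for k
  have p: "0 \<le> p k" for k by (simp add: p_def)
  define g where "g N = vol * (\<Sum>k\<in>freq_cube N. eigenvalue k * p k)" for N
  define d where "d N t = vol * (\<Sum>k\<in>freq_cube N. (1 - exp (- 2 * eigenvalue k * t)) * p k)" for N t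
  define D where "D t = (L2_norm M u)\<^sup>2 - (L2_norm M (S t u))\<^sup>2" for t
  obtain \<delta> where \<delta>: "\<delta> > 0"
    and lim': "\<forall>t u. 0 \<le> t \<longrightarrow> t \<le> \<delta> \<longrightarrow> u \<in> L2_space M \<longrightarrow>
      (\<lambda>N. vol * (\<Sum>k\<in>freq_cube N. exp (- 2 * eigenvalue k * t) * (cmod (fourier_coeff u k))\<^sup>2))
        \<longlonglongrightarrow> (L2_norm M (S t u))\<^sup>2"
    using heat_norm_tendsto by blast
  have lim: "(\<lambda>N. vol * (\<Sum>k\<in>freq_cube N. exp (- 2 * eigenvalue k * t) * p k)) \<longlonglongrightarrow> (L2_norm M (S t u))\<^sup>2"
    if "0 \<le> t" "t \<le> \<delta>" for t
    unfolding p_def using lim' that uL by simp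
  have gG: "g \<longlonglongrightarrow> G"
    unfolding g_def G_def p_def by (rule H1_gradient_norm_tendsto[OF u])
  have "incseq g"
    unfolding g_def using vol_pos p
    by (intro incseq_SucI mult_left_mono sum_mono2 freq_cube_mono) auto
  then have g_le: "g N \<le> G" for N
    using gG by (rule incseq_le)
  have dD: "(\<lambda>N. d N t) \<longlonglongrightarrow> D t" if "0 \<le> t" "t \<le> \<delta>" for t
  proof -
    have "(\<lambda>N. vol * (\<Sum>k\<in>freq_cube N. p k) - vol * (\<Sum>k\<in>freq_cube N. exp (- 2 * eigenvalue k * t) * p k)) \<longlonglongrightarrow> D t"
      unfolding D_def using Fourier_series_tendsto(2)[OF uL] lim[OF that]
      by (intro tendsto_diff) (simp_all add: p_def)
    then show ?thesis
      by (simp add: d_def left_diff_distrib sum_subtractf right_diff_distrib)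
  qed
  have d_le_D: "d N t \<le> D t" if t: "0 \<le> t" "t \<le> \<delta>" for N t
  proof (rule incseq_le[OF _ dD[OF t]])
    show "incseq (\<lambda>N. d N t)"
      unfolding d_def using vol_pos p t
      by (intro incseq_SucI mult_left_mono sum_mono2 freq_cube_mono) auto
  qed
  have D_le: "D t \<le> 2 * t * G" if t: "0 \<le> t" "t \<le> \<delta>" for t
  proof (rule LIMSEQ_le_const2[OF dD[OF t]], intro exI allI impI)
    fix N :: nat
    have "1 - exp (- 2 * eigenvalue k * t) \<le> 2 * t * eigenvalue k" for k
      using exp_ge_add_one_self[of "- 2 * eigenvalue k * t"] by (simp add: mult_ac)
    then have "d N t \<le> vol * (\<Sum>k\<in>freq_cube N. 2 * t * eigenvalue k * p k)"
      unfolding d_def using vol_pos p by (intro mult_left_mono sum_mono mult_right_mono) auto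
    also have "\<dots> = 2 * t * g N"
      by (simp add: g_def sum_distrib_left mult_ac)
    also have "\<dots> \<le> 2 * t * G"
      using g_le t by (intro mult_left_mono) auto
    finally show "d N t \<le> 2 * t * G" .
  qed
  have d_lim: "((\<lambda>t. d N t / (2 * t)) \<longlongrightarrow> g N) (at_right 0)" for N
  proof -
    have quot: "((\<lambda>t. (exp ((- 2 * eigenvalue k) * t) - 1) / t * (- 1 / 2) * p k) \<longlongrightarrow> (- 2 * eigenvalue k) * (- 1 / 2) * p k) (at_right 0)" for k
      by (intro tendsto_mult tendsto_const exp_difference_quotient)
    have "((\<lambda>t. vol * (\<Sum>k\<in>freq_cube N. (exp ((- 2 * eigenvalue k) * t) - 1) / t * (- 1 / 2) * p k)) \<longlongrightarrow>
        vol * (\<Sum>k\<in>freq_cube N. (- 2 * eigenvalue k) * (- 1 / 2) * p k)) (at_right 0)"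
      by (intro tendsto_mult[OF tendsto_const] tendsto_sum quot)
    moreover have "vol * (\<Sum>k\<in>freq_cube N. (exp ((- 2 * eigenvalue k) * t) - 1) / t * (- 1 / 2) * p k) = d N t / (2 * t)" for t
      unfolding d_def times_divide_eq_right[symmetric] sum_divide_distrib
      by (intro arg_cong[of _ _ "(*) vol"] sum.cong) (auto simp: diff_divide_distrib left_diff_distrib)
    ultimately show ?thesis by (simp add: g_def)
  qed
  have ev\<delta>: "\<forall>\<^sub>F t in at_right 0. 0 < t \<and> t \<le> \<delta>"
    unfolding eventually_at_right_field using \<delta> by (intro exI[of _ \<delta>]) auto
  have "((\<lambda>t. D t / (2 * t)) \<longlongrightarrow> G) (at_right 0)"
  proof (rule order_tendstoI)
    fix y assume "y < G"
    then obtain N where N: "y < g N"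
      using order_tendstoD(1)[OF gG] by (auto simp: eventually_sequentially)
    show "\<forall>\<^sub>F t in at_right 0. y < D t / (2 * t)"
      using order_tendstoD(1)[OF d_lim N] ev\<delta>
    proof eventually_elim
      case (elim t)
      then have "d N t / (2 * t) \<le> D t / (2 * t)"
        using d_le_D[of t N] by (intro divide_right_mono) auto
      then show ?case using elim by linarith
    qed
  next
    fix y assume "G < y"
    show "\<forall>\<^sub>F t in at_right 0. D t / (2 * t) < y"
      using ev\<delta>
    proof eventually_elim
      case (elim t)
      then have "D t / (2 * t) \<le> G"
        using D_le[of t] by (simp add: divide_le_eq mult.commute)
      then show ?case using \<open>G < y\<close> by linarith
    qed
  qed
  then show ?thesis by (simp add: D_def G_def)
qed

end

end

section \<open>Fourth powers of periodic Sobolev functions are integrable\<close>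

lemma geometric_sum_le:
  fixes x :: real
  assumes "0 \<le> x" "x < 1"
  shows "(\<Sum>j\<le>n. x ^ j) \<le> 1 / (1 - x)"
proof -
  have "(\<Sum>j\<le>n. x ^ j) = (1 - x ^ Suc n) / (1 - x)"
    using assms by (simp only: sum_gp0) simp
  also have "\<dots> \<le> 1 / (1 - x)"
    using assms zero_le_power[OF assms(1), of "Suc n"] by (intro divide_right_mono) auto
  finally show ?thesis .
qed

text \<open>
  Two applications of the Cauchy--Schwarz inequality with geometric weights: a finite sum is
  controlled in its fourth power by slightly inflated fourth powers of the summands.  The ratio
  \<open>9/10\<close> is close enough to \<open>1\<close> that its sixth power exceeds \<open>1/2\<close>, so that the weights do not spoil
  the convergence of a sum of fourth powers that decay like \<open>2\<^sup>-\<^sup>j\<close>.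
\<close>

lemma sum_power4_le:
  fixes y :: "nat \<Rightarrow> real"
  shows "(\<Sum>j\<le>n. y j) ^ 4 \<le> 216 * (\<Sum>j\<le>n. y j ^ 4 / (9/10) ^ (6 * j))"
proof -
  have sq: "(\<Sum>j\<le>n. z j)\<^sup>2 \<le> 6 * (\<Sum>j\<le>n. (z j)\<^sup>2 / (9/10) ^ (2 * j))" for z :: "nat \<Rightarrow> real"
  proof -
    have "(\<Sum>j\<le>n. (9/10) ^ j * (z j / (9/10) ^ j))\<^sup>2 \<le>
        (\<Sum>j\<le>n. ((9/10) ^ j)\<^sup>2) * (\<Sum>j\<le>n. (z j / (9/10) ^ j)\<^sup>2)"
      by (rule Cauchy_Schwarz_ineq_sum)
    also have "\<dots> \<le> 6 * (\<Sum>j\<le>n. (z j / (9/10) ^ j)\<^sup>2)"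
    proof (rule mult_right_mono)
      have "(\<Sum>j\<le>n. ((9/10 :: real) ^ j)\<^sup>2) = (\<Sum>j\<le>n. (81/100) ^ j)"
        by (simp add: power2_eq_square power_mult_distrib[symmetric])
      also have "\<dots> \<le> 6"
        by (rule order_trans[OF geometric_sum_le]) auto
      finally show "(\<Sum>j\<le>n. ((9/10 :: real) ^ j)\<^sup>2) \<le> 6" .
    qed (simp add: sum_nonneg)
    finally have "(\<Sum>j\<le>n. (9/10) ^ j * (z j / (9/10) ^ j))\<^sup>2 \<le> 6 * (\<Sum>j\<le>n. (z j / (9/10) ^ j)\<^sup>2)" .
    moreover have "(z j / (9/10) ^ j)\<^sup>2 = (z j)\<^sup>2 / (9/10) ^ (2 * j)" for j
      by (subst power_divide) (simp only: power_even_eq)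
    moreover have "(9/10) ^ j * (z j / (9/10) ^ j) = z j" for j
      by simp
    ultimately show ?thesis by (simp only:)
  qed
  have "((\<Sum>j\<le>n. y j)\<^sup>2)\<^sup>2 \<le> (6 * (\<Sum>j\<le>n. (y j)\<^sup>2 / (9/10) ^ (2 * j)))\<^sup>2"
    by (intro power_mono sq) simp
  also have "\<dots> = 36 * (\<Sum>j\<le>n. (y j)\<^sup>2 / (9/10) ^ (2 * j))\<^sup>2"
    by (simp add: power_mult_distrib)
  also have "\<dots> \<le> 36 * (6 * (\<Sum>j\<le>n. ((y j)\<^sup>2 / (9/10) ^ (2 * j))\<^sup>2 / (9/10) ^ (2 * j)))"
    by (intro mult_left_mono sq) simp
  also have "\<dots> = 216 * (\<Sum>j\<le>n. y j ^ 4 / (9/10) ^ (6 * j))"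
  proof -
    have "((y j)\<^sup>2 / (9/10) ^ (2 * j))\<^sup>2 / (9/10) ^ (2 * j) = y j ^ 4 / (9/10) ^ (6 * j)" for j
    proof -
      have "(9/10 :: real) ^ (6 * j) = (9/10) ^ (2 * j) * (9/10) ^ (2 * j) * (9/10) ^ (2 * j)"
        by (simp flip: power_add)
      then show ?thesis
        by (simp add: power_divide power2_eq_square power4_eq_xxxx)
    qed
    then show ?thesis by simp
  qed
  finally show ?thesis by simp
qed

context periodic_box
begin

text \<open>
  Outside the cube some component of the frequency is large; the constant is governed by the longest
  side of the box.
\<close>

lemma eigenvalue_outside_cube:
  obtains \<kappa> where "\<kappa> > 0" "\<And>N k. k \<notin> freq_cube N \<Longrightarrow> \<kappa> * (real N)\<^sup>2 \<le> eigenvalue k"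
proof
  let ?\<kappa> = "Min (range (\<lambda>i. (2 * pi / (b $ i - a $ i))\<^sup>2))"
  show "?\<kappa> > 0"
    using ab by (auto simp: less_imp_neq[symmetric])
  fix N and k :: "int ^ 'n" assume "k \<notin> freq_cube N"
  then obtain i where "int N < \<bar>k $ i\<bar>"
    by (auto simp: freq_cube_def not_le)
  then have "real N \<le> \<bar>real_of_int (k $ i)\<bar>"
    by linarith
  then have "(real N)\<^sup>2 \<le> (real_of_int (k $ i))\<^sup>2"
    by (metis abs_of_nat abs_le_square_iff)
  moreover have "?\<kappa> \<le> (2 * pi / (b $ i - a $ i))\<^sup>2"
    by (intro Min_le) auto
  ultimately have "?\<kappa> * (real N)\<^sup>2 \<le> (2 * pi / (b $ i - a $ i))\<^sup>2 * (real_of_int (k $ i))\<^sup>2"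
    by (intro mult_mono) auto
  also have "\<dots> = (freq k i)\<^sup>2"
    by (simp add: freq_def power_mult_distrib power_divide)
  also have "\<dots> \<le> eigenvalue k"
    unfolding eigenvalue_def by (rule member_le_sum) auto
  finally show "?\<kappa> * (real N)\<^sup>2 \<le> eigenvalue k" .
qed

lemma integrable_char_sum_power4: "integrable M (\<lambda>x. cmod (char_sum A c x) ^ 4)"
proof -
  have "continuous_on UNIV (\<lambda>x. complex_of_real (cmod (char_sum A c x) ^ 4))"
    by (intro continuous_intros continuous_char_sum)
  then have "integrable M (\<lambda>x. complex_of_real (cmod (char_sum A c x) ^ 4))"
    by (rule continuous_integrable_M)
  from integrable_Re[OF this] show ?thesis by simp
qed

text \<open>
  The sup norm of a trigonometric sum grows at most with the square root of the number of modes;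
  it is interpolated with the \<open>L\<^sup>2\<close>-norm.
\<close>

lemma integral_char_sum_power4:
  assumes A: "finite A"
  shows "(LINT x|M. cmod (char_sum A c x) ^ 4) \<le> vol * real (card A) * (\<Sum>k\<in>A. (cmod (c k))\<^sup>2)\<^sup>2"
proof -
  let ?s = "\<Sum>k\<in>A. (cmod (c k))\<^sup>2"
  have sup: "(cmod (char_sum A c x))\<^sup>2 \<le> real (card A) * ?s" for x
  proof -
    have "cmod (char_sum A c x) \<le> (\<Sum>k\<in>A. cmod (c k))"
      unfolding char_sum_def by (rule order_trans[OF norm_sum]) (simp add: norm_mult)
    then have "(cmod (char_sum A c x))\<^sup>2 \<le> (\<Sum>k\<in>A. cmod (c k))\<^sup>2"
      by (intro power_mono) auto
    also have "\<dots> \<le> ?s * real (card A)"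
      by (rule sum_squared_le_sum_of_squares)
    finally show ?thesis by (simp add: mult.commute)
  qed
  have int2: "integrable M (\<lambda>x. (cmod (char_sum A c x))\<^sup>2)"
    by (rule L2_spaceD(2)[OF char_sum_L2])
  have "cmod (char_sum A c x) ^ 4 \<le> real (card A) * ?s * (cmod (char_sum A c x))\<^sup>2" for x
    using mult_right_mono[OF sup[of x], of "(cmod (char_sum A c x))\<^sup>2"]
    by (simp add: power2_eq_square power4_eq_xxxx mult_ac)
  then have "(LINT x|M. cmod (char_sum A c x) ^ 4) \<le> (LINT x|M. real (card A) * ?s * (cmod (char_sum A c x))\<^sup>2)"
    by (intro integral_mono integrable_char_sum_power4 integrable_mult_right int2)
  also have "\<dots> = real (card A) * ?s * (vol * ?s)"
    using L2_norm_char_sum[OF A, of c] by (simp add: L2_norm_sq)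
  finally show ?thesis by (simp add: power2_eq_square mult_ac)
qed

text \<open>
  The Sobolev embedding of \<open>H\<^sup>1\<close> into \<open>L\<^sup>4\<close> by dyadic decomposition.  The frequencies of size about
  \<open>2\<^sup>j\<close> number at most a constant times \<open>8\<^sup>j\<close> in dimension at most three, while a square-integrable
  gradient makes the squared \<open>L\<^sup>2\<close>-norm of that part of the series \<open>O(4\<^sup>-\<^sup>j)\<close>.  So its fourth power
  has integral \<open>O(8\<^sup>j 16\<^sup>-\<^sup>j) = O(2\<^sup>-\<^sup>j)\<close>, which is summable with room to spare for the weights.
\<close>

theorem H1_integrable_power4:
  assumes u: "u \<in> H1_per a b" and dim: "CARD('n) \<le> 3"
  shows "integrable M (\<lambda>x. cmod (u x) ^ 4)"
proof -
  have uL: "u \<in> L2_space M" using u by (simp add: H1_per_def)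
  let ?c = "fourier_coeff u"
  define p where "p k = (cmod (?c k))\<^sup>2" for k
  have p: "0 \<le> p k" for k by (simp add: p_def)
  have le_lim: "f N \<le> l" if "f \<longlonglongrightarrow> l" "f = (\<lambda>N. vol * (\<Sum>k\<in>freq_cube N. h k))" "\<And>k. 0 \<le> h k" for f l N and h :: "int ^ 'n \<Rightarrow> real"
  proof (rule incseq_le[OF _ that(1)])
    show "incseq f"
      unfolding that(2) using vol_pos that(3)
      by (intro incseq_SucI mult_left_mono sum_mono2 freq_cube_mono) auto
  qed
  obtain K where K: "\<And>N. (\<Sum>k\<in>freq_cube N. eigenvalue k * p k) \<le> K"
  proof
    show "(\<Sum>k\<in>freq_cube N. eigenvalue k * p k) \<le> (\<Sum>i\<in>UNIV. (L2_norm M (weak_deriv a b i u))\<^sup>2) / vol" for N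
      using le_lim[OF H1_gradient_norm_tendsto[OF u] refl] vol_pos
      by (simp add: p_def pos_le_divide_eq mult.commute)
  qed
  obtain P where P: "\<And>N. (\<Sum>k\<in>freq_cube N. p k) \<le> P"
  proof
    show "(\<Sum>k\<in>freq_cube N. p k) \<le> (L2_norm M u)\<^sup>2 / vol" for N
      using le_lim[OF Fourier_series_tendsto(2)[OF uL] refl] vol_pos
      by (simp add: p_def pos_le_divide_eq mult.commute)
  qed
  have K0: "0 \<le> K" using K[of 0] p by (meson eigenvalue_nonneg mult_nonneg_nonneg order_trans sum_nonneg)
  have P0: "0 \<le> P" using P[of 0] p by (meson order_trans sum_nonneg)
  obtain \<kappa> where \<kappa>: "\<kappa> > 0" and outside: "\<And>N k. k \<notin> freq_cube N \<Longrightarrow> \<kappa> * (real N)\<^sup>2 \<le> eigenvalue k"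
    using eigenvalue_outside_cube by metis
  define block where "block j = (if j = 0 then freq_cube 1 else freq_cube (2 ^ j) - freq_cube (2 ^ (j - 1)))" for j :: nat
  have fin: "finite (block j)" for j by (simp add: block_def)
  define R where "R = 4 * K / \<kappa> + P"
  have R0: "0 \<le> R" using K0 P0 \<kappa> by (simp add: R_def)
  have mass: "(\<Sum>k\<in>block j. p k) \<le> R * (1/4) ^ j" for j
  proof (cases j)
    case 0
    have "0 \<le> 4 * K / \<kappa>" using K0 \<kappa> by simp
    then have "(\<Sum>k\<in>freq_cube 1. p k) \<le> R" using P[of 1] unfolding R_def by linarith
    then show ?thesis using 0 by (simp add: block_def)
  next
    case (Suc i)
    \<comment> \<open>the block lies outside the cube of radius \<open>2\<^sup>i\<close>, where eigenvalues are at least \<open>\<kappa> 4\<^sup>i\<close>\<close>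
    have "\<kappa> * 4 ^ i * (\<Sum>k\<in>block j. p k) \<le> (\<Sum>k\<in>block j. eigenvalue k * p k)"
      unfolding sum_distrib_left
    proof (intro sum_mono mult_right_mono p)
      fix k assume "k \<in> block j"
      then have "k \<notin> freq_cube (2 ^ i)" using Suc by (simp add: block_def)
      then show "\<kappa> * 4 ^ i \<le> eigenvalue k"
        using outside[of k "2 ^ i"] by (simp add: power_mult[symmetric] mult.commute[of i] power_mult)
    qed
    also have "\<dots> \<le> (\<Sum>k\<in>freq_cube (2 ^ j). eigenvalue k * p k)"
      using Suc p by (intro sum_mono2) (auto simp: block_def)
    also have "\<dots> \<le> K" by (rule K)
    finally have "(\<Sum>k\<in>block j. p k) \<le> K / (\<kappa> * 4 ^ i)"
      using \<kappa> by (simp add: pos_le_divide_eq mult.commute)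
    also have "\<dots> = 4 * K / \<kappa> * (1/4) ^ j"
      using \<kappa> Suc by (simp add: field_simps power_divide)
    also have "\<dots> \<le> R * (1/4) ^ j"
      using P0 by (intro mult_right_mono) (auto simp: R_def)
    finally show ?thesis .
  qed
  have card: "real (card (block j)) \<le> 27 * 8 ^ j" for j
  proof -
    have "card (block j) \<le> card (freq_cube (2 ^ j))"
      by (intro card_mono) (auto simp: block_def)
    also have "\<dots> \<le> (2 * 2 ^ j + 1) ^ CARD('n)"
      by (rule card_freq_cube)
    also have "\<dots> \<le> (3 * 2 ^ j) ^ CARD('n)"
      by (intro power_mono) auto
    also have "\<dots> \<le> (3 * 2 ^ j) ^ 3"
      using dim by (intro power_increasing) auto
    also have "\<dots> = 27 * 8 ^ j"
      by (simp add: power_mult_distrib power_mult[symmetric] mult.commute[of j] power_mult)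
    finally have "real (card (block j)) \<le> real (27 * 8 ^ j)"
      by (simp only: of_nat_le_iff)
    then show ?thesis by simp
  qed
  let ?v = "\<lambda>j x. cmod (char_sum (block j) ?c x)"
  have block4: "(LINT x|M. ?v j x ^ 4) \<le> 27 * vol * R\<^sup>2 * (1/2) ^ j" for j
  proof -
    have "(LINT x|M. ?v j x ^ 4) \<le> vol * real (card (block j)) * (\<Sum>k\<in>block j. p k)\<^sup>2"
      unfolding p_def by (rule integral_char_sum_power4[OF fin])
    also have "\<dots> \<le> vol * (27 * 8 ^ j) * (R * (1/4) ^ j)\<^sup>2"
      using vol_pos p by (intro mult_mono power_mono mass card mult_left_mono) (auto intro!: sum_nonneg)
    also have "\<dots> = 27 * vol * R\<^sup>2 * (8 ^ j * ((1/4) ^ j * (1/4) ^ j))"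
      by (simp add: power2_eq_square)
    also have "8 ^ j * ((1/4) ^ j * (1/4) ^ j) = (1/2 :: real) ^ j"
      unfolding power_mult_distrib[symmetric] by simp
    finally show ?thesis .
  qed
  have partial: "char_sum (freq_cube (2 ^ n)) ?c x = (\<Sum>j\<le>n. char_sum (block j) ?c x)" for n x
  proof (induction n)
    case 0
    then show ?case by (simp add: block_def)
  next
    case (Suc n)
    have "freq_cube (2 ^ n) \<subseteq> freq_cube (2 ^ Suc n)"
      by (rule freq_cube_mono) simp
    then have "char_sum (freq_cube (2 ^ Suc n)) ?c x - char_sum (freq_cube (2 ^ n)) ?c x = char_sum (block (Suc n)) ?c x"
      using char_sum_diff[OF finite_freq_cube] by (simp add: block_def)
    then show ?case using Suc by (simp add: algebra_simps)
  qed
  define B where "B = 216 * (27 * vol * R\<^sup>2 * 20)"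
  have bound4: "(LINT x|M. cmod (char_sum (freq_cube (2 ^ n)) ?c x) ^ 4) \<le> B" for n
  proof -
    have "cmod (char_sum (freq_cube (2 ^ n)) ?c x) ^ 4 \<le> 216 * (\<Sum>j\<le>n. ?v j x ^ 4 / (9/10) ^ (6 * j))" for x
    proof -
      have "cmod (char_sum (freq_cube (2 ^ n)) ?c x) \<le> (\<Sum>j\<le>n. ?v j x)"
        unfolding partial by (rule norm_sum)
      then have "cmod (char_sum (freq_cube (2 ^ n)) ?c x) ^ 4 \<le> (\<Sum>j\<le>n. ?v j x) ^ 4"
        by (intro power_mono) auto
      also have "\<dots> \<le> 216 * (\<Sum>j\<le>n. ?v j x ^ 4 / (9/10) ^ (6 * j))"
        by (rule sum_power4_le)
      finally show ?thesis .
    qed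
    then have "(LINT x|M. cmod (char_sum (freq_cube (2 ^ n)) ?c x) ^ 4) \<le> (LINT x|M. 216 * (\<Sum>j\<le>n. ?v j x ^ 4 / (9/10) ^ (6 * j)))"
      by (intro integral_mono integrable_char_sum_power4 integrable_mult_right Bochner_Integration.integrable_sum
        integrable_divide) auto
    also have "\<dots> = 216 * (\<Sum>j\<le>n. (LINT x|M. ?v j x ^ 4) / (9/10) ^ (6 * j))"
      by (simp add: integrable_char_sum_power4)
    also have "\<dots> \<le> 216 * (\<Sum>j\<le>n. 27 * vol * R\<^sup>2 * (1/2) ^ j / (9/10) ^ (6 * j))"
      by (intro mult_left_mono sum_mono divide_right_mono block4) auto
    also have "\<dots> = 216 * (27 * vol * R\<^sup>2 * (\<Sum>j\<le>n. (1/2) ^ j / (9/10) ^ (6 * j)))"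
      by (simp add: sum_distrib_left)
    also have "\<dots> \<le> B"
      unfolding B_def
    proof (intro mult_left_mono)
      have "(\<Sum>j\<le>n. (1/2 :: real) ^ j / (9/10) ^ (6 * j)) = (\<Sum>j\<le>n. (500000 / 531441) ^ j)"
      proof (rule sum.cong)
        have "(1/2 :: real) / (9/10) ^ 6 = 500000 / 531441"
          by (simp add: power_divide)
        then show "(1/2 :: real) ^ j / (9/10) ^ (6 * j) = (500000 / 531441) ^ j" for j
          by (simp only: power_mult power_divide[of "1/2" "(9/10) ^ 6" j, symmetric])
      qed simp
      also have "\<dots> \<le> 20"
        by (rule order_trans[OF geometric_sum_le]) auto
      finally show "(\<Sum>j\<le>n. (1/2 :: real) ^ j / (9/10) ^ (6 * j)) \<le> 20" .
    qed (use vol_pos in auto)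
    finally show ?thesis .
  qed
  let ?d = "\<lambda>n x. u x - char_sum (freq_cube (2 ^ n)) ?c x"
  have dL: "?d n \<in> L2_space M" for n
    by (intro L2_space_diff uL char_sum_L2)
  have one: "(\<lambda>x. 1) \<in> L2_space M" by (rule continuous_L2) simp
  have pow: "filterlim (\<lambda>n. 2 ^ n :: nat) sequentially sequentially"
    by (rule filterlim_at_top_mono[OF filterlim_ident]) (auto intro: less_imp_le less_exp)
  have "(\<lambda>n. LINT x|M. norm (?d n x)) \<longlonglongrightarrow> 0"
  proof (rule tendsto_sandwich[OF _ _ tendsto_const])
    have "(\<lambda>n. L2_norm M (?d n) * L2_norm M (\<lambda>x. 1)) \<longlonglongrightarrow> 0 * L2_norm M (\<lambda>x. 1)"
      by (intro tendsto_mult tendsto_const filterlim_compose[OF Fourier_series_tendsto(1)[OF uL] pow])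
    then show "(\<lambda>n. L2_norm M (?d n) * L2_norm M (\<lambda>x. 1)) \<longlonglongrightarrow> 0" by simp
    show "\<forall>\<^sub>F n in sequentially. (LINT x|M. norm (?d n x)) \<le> L2_norm M (?d n) * L2_norm M (\<lambda>x. 1)"
      using L2_Cauchy_Schwarz_abs[OF dL one] by simp
  qed (simp add: integral_nonneg_AE)
  then obtain r where r: "AE x in M. (\<lambda>n. ?d (r n) x) \<longlonglongrightarrow> 0"
    using tendsto_L1_AE_subseq[of M ?d, OF L2_integrable[OF dL]] by blast
  have "integrable M (\<lambda>x. cmod (u x) ^ 4) \<and> (LINT x|M. cmod (u x) ^ 4) \<le> B"
  proof (rule integrable_Fatou)
    show "AE x in M. (\<lambda>n. cmod (char_sum (freq_cube (2 ^ r n)) ?c x) ^ 4) \<longlonglongrightarrow> cmod (u x) ^ 4"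
      using r
    proof eventually_elim
      case (elim x)
      then have "(\<lambda>n. cmod (u x - ?d (r n) x) ^ 4) \<longlonglongrightarrow> cmod (u x - 0) ^ 4"
        by (intro tendsto_power tendsto_norm tendsto_diff tendsto_const)
      then show ?case by simp
    qed
    show "(\<lambda>x. cmod (u x) ^ 4) \<in> borel_measurable M"
      using L2_spaceD(1)[OF uL] by simp
  qed (auto intro: integrable_char_sum_power4 bound4)
  then show ?thesis by simp
qed

end

section \<open>Convergence of the relaxed energy\<close>

theorem lemma2p3:
  fixes a b :: "real ^ 'n"
    and V :: "real ^ 'n \<Rightarrow> real"
    and \<beta> :: real
    and S :: "real \<Rightarrow> (real ^ 'n \<Rightarrow> complex) \<Rightarrow> real ^ 'n \<Rightarrow> complex"
    and \<phi> :: "real ^ 'n \<Rightarrow> complex"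
  assumes "CARD('n) \<in> {1, 2, 3}"
    and "\<And>i. a $ i < b $ i"
    and "heat_semigroup a b S"
    and "\<beta> > 0"
    and "V \<in> Linf_space (box_measure a b)"
    and "AE x in box_measure a b. V x \<ge> 0"
    and "\<phi> \<in> H1_per a b"
    and "L2_norm (box_measure a b) \<phi> = 1"
  shows "((\<lambda>\<tau>. relaxed_energy a b S V \<beta> \<tau> \<phi>) \<longlongrightarrow> GP_energy a b V \<beta> \<phi>) (at_right 0)"
proof -
  interpret periodic_box a b by standard (rule assms(2))
  have \<phi>: "\<phi> \<in> L2_space M" using assms(7) by (simp add: H1_per_def)
  have wp: "weak_partial a b i \<phi> (weak_deriv a b i \<phi>)" for i
    using assms(7) weak_partial_weak_deriv unfolding H1_per_def by blast
  have int4: "integrable M (\<lambda>x. \<beta> / 2 * cmod (\<phi> x) ^ 4)"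
    using assms(1) by (intro integrable_mult_right H1_integrable_power4 assms(7)) auto
  have intV: "integrable M (\<lambda>x. V x * (cmod (\<phi> x))\<^sup>2)"
  proof -
    obtain C where C: "AE x in M. \<bar>V x\<bar> \<le> C" and V: "V \<in> borel_measurable M"
      using assms(5) by (auto simp: Linf_space_def)
    show ?thesis
    proof (rule Bochner_Integration.integrable_bound)
      show "integrable M (\<lambda>x. C * (cmod (\<phi> x))\<^sup>2)"
        by (intro integrable_mult_right L2_spaceD(2) \<phi>)
      show "(\<lambda>x. V x * (cmod (\<phi> x))\<^sup>2) \<in> borel_measurable M"
        using V L2_spaceD(1)[OF \<phi>] by measurable
      show "AE x in M. norm (V x * (cmod (\<phi> x))\<^sup>2) \<le> norm (C * (cmod (\<phi> x))\<^sup>2)"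
        using C
      proof eventually_elim
        case (elim x)
        then have "\<bar>V x\<bar> * (cmod (\<phi> x))\<^sup>2 \<le> \<bar>C\<bar> * (cmod (\<phi> x))\<^sup>2"
          by (intro mult_right_mono) auto
        then show ?case by (simp add: abs_mult)
      qed
    qed
  qed
  define P where "P = (LINT x|M. V x * (cmod (\<phi> x))\<^sup>2) + (LINT x|M. \<beta> / 2 * cmod (\<phi> x) ^ 4)"
  define G where "G = (\<Sum>i\<in>UNIV. (L2_norm M (weak_deriv a b i \<phi>))\<^sup>2)"
  have split: "(LINT x|M. f x + V x * (cmod (\<phi> x))\<^sup>2 + \<beta> / 2 * cmod (\<phi> x) ^ 4) = (LINT x|M. f x) + P"
    if "integrable M f" for f
    using that intV int4 unfolding P_def by (simp del: integral_mult_right_zero)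
  have GP: "GP_energy a b V \<beta> \<phi> = G / 2 + P"
  proof -
    have int: "integrable M (\<lambda>x. (cmod (weak_deriv a b i \<phi> x))\<^sup>2)" for i
      by (rule L2_spaceD(2)[OF weak_partialD(2)[OF wp]])
    then have "integrable M (\<lambda>x. 1 / 2 * (\<Sum>i\<in>UNIV. (cmod (weak_deriv a b i \<phi> x))\<^sup>2))"
      by (intro integrable_mult_right Bochner_Integration.integrable_sum)
    then have "GP_energy a b V \<beta> \<phi> = (LINT x|M. 1 / 2 * (\<Sum>i\<in>UNIV. (cmod (weak_deriv a b i \<phi> x))\<^sup>2)) + P"
      unfolding GP_energy_def by (rule split)
    also have "(LINT x|M. 1 / 2 * (\<Sum>i\<in>UNIV. (cmod (weak_deriv a b i \<phi> x))\<^sup>2)) = G / 2"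
      using int by (simp add: G_def L2_norm_sq)
    finally show ?thesis .
  qed
  have relaxed: "relaxed_energy a b S V \<beta> \<tau> \<phi> =
      ((L2_norm M \<phi>)\<^sup>2 - (L2_norm M (S (\<tau> / 2) \<phi>))\<^sup>2) / (2 * (\<tau> / 2)) / 2 + P" if \<tau>: "0 < \<tau>" for \<tau>
  proof -
    have "S (\<tau> / 2) \<phi> \<in> L2_space M"
      using S_C0[OF assms(3)] \<tau> \<phi> by (simp add: C0_semigroup_def)
    then have "integrable M (\<lambda>x. - 1 / (2 * \<tau>) * (cmod (S (\<tau> / 2) \<phi> x))\<^sup>2)"
      by (intro integrable_mult_right L2_spaceD(2))
    then have "relaxed_energy a b S V \<beta> \<tau> \<phi> =
        1 / (2 * \<tau>) + ((LINT x|M. - 1 / (2 * \<tau>) * (cmod (S (\<tau> / 2) \<phi> x))\<^sup>2) + P)"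
      unfolding relaxed_energy_def by (simp only: split)
    then show ?thesis
      using \<tau> assms(8) by (simp add: L2_norm_sq field_simps)
  qed
  have "filterlim (\<lambda>\<tau>. \<tau> / 2) (at_right 0) (at_right (0 :: real))"
    unfolding filterlim_at
  proof
    show "((\<lambda>\<tau>. \<tau> / 2) \<longlongrightarrow> 0) (at_right (0 :: real))"
      using tendsto_divide[OF tendsto_ident_at tendsto_const, of "2 :: real" 0 "{0<..}"] by simp
    show "\<forall>\<^sub>F \<tau> in at_right (0 :: real). \<tau> / 2 \<in> {0<..} \<and> \<tau> / 2 \<noteq> 0"
      by (rule eventually_mono[OF eventually_at_right_less[of 0]]) auto
  qed
  from filterlim_compose[OF heat_energy_dissipation[OF assms(3,7)] this]
  have "((\<lambda>\<tau>. ((L2_norm M \<phi>)\<^sup>2 - (L2_norm M (S (\<tau> / 2) \<phi>))\<^sup>2) / (2 * (\<tau> / 2)) / 2 + P) \<longlongrightarrow> G / 2 + P) (at_right 0)"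
    unfolding G_def by (intro tendsto_add tendsto_const tendsto_divide) auto
  moreover have "\<forall>\<^sub>F \<tau> in at_right 0. ((L2_norm M \<phi>)\<^sup>2 - (L2_norm M (S (\<tau> / 2) \<phi>))\<^sup>2) / (2 * (\<tau> / 2)) / 2 + P
      = relaxed_energy a b S V \<beta> \<tau> \<phi>"
    by (rule eventually_mono[OF eventually_at_right_less[of 0]]) (rule relaxed[symmetric])
  ultimately show ?thesis
    unfolding GP by (rule Lim_transform_eventually)
qed

end
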